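(* Let $C$ be a fixed Coxeter element and $\Pi$ a simple root system compatible with $C$. Then there exists a unique bijection $\Phi^\Pi\colon R\to\widehat I$ with the following properties: (1) $\Phi^\Pi(C\beta)=\tau\Phi^\Pi(\beta)$ for all $\beta\in R$. (2) $\Phi^\Pi(\beta_i^\Pi)=(i,\eta(i))$ for all $i\in I$, for some function $\eta\colon I\to\mathbb Z_{2h}$. (3) If $i\to j$ in the orientation $\Omega_\Pi$ and $\Phi^\Pi(\beta_i^\Pi)=(i,n)$, then $\Phi^\Pi(\beta_j^\Pi)=(j,n+1)$. (4) On the $C$-orbit of $\beta_{i_0}^\Pi$, $\Phi^\Pi$ coincides with $\Phi_0$.
   Context: $R\subset E$ is a reduced, irreducible, simply-laced root system (type $A,D,E$) of rank $r$ in a Euclidean space $E$ with $W$-invariant inner product $(\cdot,\cdot)$ normalized so that $(\alpha,\alpha)=2$ for $\alpha\in R$; $W$ is its Weyl group. A simple root system $\Pi\subset R$ is a base of $R$. There is a fixed index set $I$ and, for each simple root system $\Pi$, a bijection $I\to\Pi$, $i\mapsto\alpha_i^\Pi$, such that $w(\alpha_i^\Pi)=\alpha_i^{w(\Pi)}$ for all $w\in W$. For $i\ne j$ put $n_{ij}=-(\alpha_i^\Pi,\alpha_j^\Pi)\in\{0,1\}$ (independent of $\Pi$); $I$ also denotes the Dynkin diagram, the graph with vertex set $I$ and $n_{ij}$ edges between $i$ and $j$. Let $s_i^\Pi$ be the reflection in $\alpha_i^\Pi$. A Coxeter element is a product, in some order, of all the simple reflections of some simple root system, each taken once; $h$ denotes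 the order of $C$ (the Coxeter number). $\Pi$ is compatible with $C$ if $C=s^\Pi_{i_1}\cdots s^\Pi_{i_r}$ for some enumeration $i_1,\dots,i_r$ of $I$. For compatible $\Pi$, the orientation $\Omega_\Pi$ of $I$ is: for $n_{ij}=1$, $i\to j$ if $s_i^\Pi$ precedes $s_j^\Pi$ in such an expression for $C$ (independent of the expression). Write $i\leqslant j$ if there is an oriented path (possibly of length $0$) from $i$ to $j$ in $\Omega_\Pi$, and set $\beta_i^\Pi=\sum_{j\leqslant i}\alpha_j^\Pi$. The $C$-orbit of $\beta_i^\Pi$ does not depend on the choice of $\Pi$ compatible with $C$. Fix $p\colon I\to\mathbb Z_2$ with $p(i)=p(j)+1$ whenever $i,j$ are connected by an edge, and let $\widehat I=\{(i,n)\in I\times\mathbb Z_{2h}\mid p(i)+n\equiv 0 \bmod 2\}$, with $\tau\colon\widehat I\to\widehat I$, $\tau(i,n)=(i,n+2)$. Fix $i_0\in I$ and a bijection $\Phi_0$ from the $C$-orbit of $\beta_{i_0}^\Pi$ onto $\{(i_0,n)\in\widehat I\}$ with $\Phi_0(C\beta)=\tau\Phi_0(\beta)$ (the choice of $i_0,\Phi_0$ is independent of $\Pi$). *)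

theory Defs
  imports "HOL-Analysis.Analysis" "HOL-Library.FuncSet" "HOL-Library.Z2"
begin

definition root_reflection :: "'a::euclidean_space \<Rightarrow> 'a \<Rightarrow> 'a" where
  "root_reflection a v = v - (2 * (v \<bullet> a) / (a \<bullet> a)) *\<^sub>R a"

text \<open>The ambient Euclidean space is the whole type, and its inner product is the
  one of the type; it is Weyl-group invariant because reflections are isometries.\<close>

definition root_system :: "'a::euclidean_space set \<Rightarrow> bool" where
  "root_system R \<longleftrightarrow>
     finite R \<and> span R = UNIV \<and> 0 \<notin> R \<and>
     (\<forall>a\<in>R. \<forall>b\<in>R. root_reflection a b \<in> R) \<and>
     (\<forall>a\<in>R. \<forall>b\<in>R. 2 * (b \<bullet> a) / (a \<bullet> a) \<in> \<int>)"

definition reduced_root_system :: "'a::euclidean_space set \<Rightarrow> bool" where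
  "reduced_root_system R \<longleftrightarrow> root_system R \<and> (\<forall>a\<in>R. \<forall>c. c *\<^sub>R a \<in> R \<longrightarrow> c = 1 \<or> c = - 1)"

definition irreducible_root_system :: "'a::euclidean_space set \<Rightarrow> bool" where
  "irreducible_root_system R \<longleftrightarrow>
     root_system R \<and> R \<noteq> {} \<and>
     \<not> (\<exists>A B. A \<noteq> {} \<and> B \<noteq> {} \<and> A \<inter> B = {} \<and> A \<union> B = R \<and> (\<forall>a\<in>A. \<forall>b\<in>B. a \<bullet> b = 0))"

text \<open>Simply-laced includes the normalization of the inner product: all roots have
  squared length 2.\<close>

definition simply_laced :: "'a::euclidean_space set \<Rightarrow> bool" where
  "simply_laced R \<longleftrightarrow> (\<forall>a\<in>R. a \<bullet> a = 2)"

text \<open>Reflections are involutions, so closing under composition with them already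
  yields the group they generate.\<close>

inductive_set weyl_group :: "'a::euclidean_space set \<Rightarrow> ('a \<Rightarrow> 'a) set"
  for R :: "'a set" where
  id: "id \<in> weyl_group R"
| step: "w \<in> weyl_group R \<Longrightarrow> a \<in> R \<Longrightarrow> root_reflection a \<circ> w \<in> weyl_group R"

definition simple_root_system :: "'a::euclidean_space set \<Rightarrow> 'a set \<Rightarrow> bool" where
  "simple_root_system R P \<longleftrightarrow>
     P \<subseteq> R \<and> independent P \<and> span P = UNIV \<and>
     (\<forall>b\<in>R. \<exists>c :: 'a \<Rightarrow> int.
        b = (\<Sum>a\<in>P. of_int (c a) *\<^sub>R a) \<and> ((\<forall>a\<in>P. c a \<ge> 0) \<or> (\<forall>a\<in>P. c a \<le> 0)))"

text \<open>\<open>\<alpha> P i\<close> is the simple root of \<open>P\<close> with index \<open>i\<close>.\<close>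

definition equivariant_labelling ::
  "'a::euclidean_space set \<Rightarrow> 'i set \<Rightarrow> ('a set \<Rightarrow> 'i \<Rightarrow> 'a) \<Rightarrow> bool" where
  "equivariant_labelling R I \<alpha> \<longleftrightarrow>
     (\<forall>P. simple_root_system R P \<longrightarrow> bij_betw (\<alpha> P) I P) \<and>
     (\<forall>P. simple_root_system R P \<longrightarrow>
        (\<forall>w\<in>weyl_group R. \<forall>i\<in>I. w (\<alpha> P i) = \<alpha> (w ` P) i))"

text \<open>The remaining definitions refer to a single simple root system, through its
  labelling \<open>a\<close> (that is, \<open>a = \<alpha> P\<close>).\<close>

definition dynkin_edge :: "'i set \<Rightarrow> ('i \<Rightarrow> 'a::euclidean_space) \<Rightarrow> 'i \<Rightarrow> 'i \<Rightarrow> bool" where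
  "dynkin_edge I a i j \<longleftrightarrow> i \<in> I \<and> j \<in> I \<and> i \<noteq> j \<and> - (a i \<bullet> a j) = 1"

definition reflection_product :: "'a::euclidean_space list \<Rightarrow> 'a \<Rightarrow> 'a" where
  "reflection_product as = foldr (\<circ>) (map root_reflection as) id"

definition coxeter_element :: "'a::euclidean_space set \<Rightarrow> ('a \<Rightarrow> 'a) \<Rightarrow> bool" where
  "coxeter_element R C \<longleftrightarrow>
     (\<exists>P as. simple_root_system R P \<and> distinct as \<and> set as = P \<and> C = reflection_product as)"

definition coxeter_number :: "('a \<Rightarrow> 'a) \<Rightarrow> nat" where
  "coxeter_number C = (LEAST n. n > 0 \<and> C ^^ n = id)"

text \<open>\<open>is\<close> enumerates the index set so that \<open>C\<close> is the product of the simple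
  reflections in that order.\<close>

definition coxeter_expression ::
  "'i set \<Rightarrow> ('i \<Rightarrow> 'a::euclidean_space) \<Rightarrow> ('a \<Rightarrow> 'a) \<Rightarrow> 'i list \<Rightarrow> bool" where
  "coxeter_expression I a C is \<longleftrightarrow>
     distinct is \<and> set is = I \<and> C = reflection_product (map a is)"

definition compatible :: "'i set \<Rightarrow> ('i \<Rightarrow> 'a::euclidean_space) \<Rightarrow> ('a \<Rightarrow> 'a) \<Rightarrow> bool" where
  "compatible I a C \<longleftrightarrow> (\<exists>is. coxeter_expression I a C is)"

definition precedes :: "'i list \<Rightarrow> 'i \<Rightarrow> 'i \<Rightarrow> bool" where
  "precedes is i j \<longleftrightarrow> (\<exists>k l. k < l \<and> l < length is \<and> is ! k = i \<and> is ! l = j)"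

text \<open>Whether \<open>i\<close> precedes an adjacent \<open>j\<close> does not depend on the expression: the two
  reflections do not commute.\<close>

definition orientation ::
  "'i set \<Rightarrow> ('i \<Rightarrow> 'a::euclidean_space) \<Rightarrow> ('a \<Rightarrow> 'a) \<Rightarrow> 'i \<Rightarrow> 'i \<Rightarrow> bool" where
  "orientation I a C i j \<longleftrightarrow>
     dynkin_edge I a i j \<and> (\<exists>is. coxeter_expression I a C is \<and> precedes is i j)"

definition beta_root ::
  "'i set \<Rightarrow> ('i \<Rightarrow> 'a::euclidean_space) \<Rightarrow> ('a \<Rightarrow> 'a) \<Rightarrow> 'i \<Rightarrow> 'a" where
  "beta_root I a C i = (\<Sum>j | j \<in> I \<and> (orientation I a C)\<^sup>*\<^sup>* j i. a j)"

text \<open>A Coxeter element has finite order, so natural powers suffice for its orbits.\<close>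

definition orbit_of :: "('a \<Rightarrow> 'a) \<Rightarrow> 'a \<Rightarrow> 'a set" where
  "orbit_of C b = {(C ^^ k) b | k. True}"

text \<open>The residues modulo \<open>2 * h\<close> are represented by the integers \<open>0, ..., 2 * h - 1\<close>;
  the type \<open>bit\<close> is the field of residues modulo 2.\<close>

definition hat_vertices :: "'i set \<Rightarrow> ('i \<Rightarrow> bit) \<Rightarrow> nat \<Rightarrow> ('i \<times> int) set" where
  "hat_vertices I p h = {(i, n). i \<in> I \<and> n \<in> {0..<2 * int h} \<and> p i + of_int n = 0}"

definition hat_shift :: "nat \<Rightarrow> 'i \<times> int \<Rightarrow> 'i \<times> int" where
  "hat_shift h = (\<lambda>(i, n). (i, (n + 2) mod (2 * int h)))"

end

theory Submission
  imports Defs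
begin

text \<open>Let \<open>N(i)\<close> be the set of neighbours of \<open>i\<close> in the Dynkin diagram. The roots
  \<open>\<gamma>(i, n)\<close> defined by \<open>\<gamma>(i, \<eta> i) = \<beta> i\<close> and \<open>\<gamma>(i, n + 2) = C \<gamma>(i, n)\<close>, for a
  height function \<open>\<eta>\<close> of the orientation, satisfy the mesh relation
  \<open>\<gamma>(i, n) + \<gamma>(i, n + 2) = (\<Sum>j\<in>N(i). \<gamma>(j, n + 1))\<close>. Reflecting at sources shows that for
  every \<open>n\<close> the roots \<open>\<gamma>(i, n)\<close> together with the \<open>- \<gamma>(j, n - 1)\<close> form a simple system.

  Let \<open>v\<close> be the Perron vector of the diagram, with eigenvalue \<open>2 cos \<theta>\<close>. By the mesh relation there
  is a linear map \<open>Z\<close> to the complex plane with \<open>Z \<gamma>(i, n) = v i exp(\<i> \<theta> n)\<close>. Positivity with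
  respect to the above simple systems forbids roots with phase strictly between \<open>\<theta>(n - 1)\<close> and
  \<open>\<theta> n\<close> modulo \<open>\<pi>\<close>, and makes the \<open>\<gamma>(i, n)\<close> the only roots of phase \<open>\<theta> n\<close>. Hence
  \<open>\<theta> = \<pi> / m\<close> for an integer \<open>m\<close>, and \<open>C ^^ m\<close> permutes a simple system, so it is the identity
  and \<open>m\<close> is the Coxeter number. Thus \<open>\<gamma>\<close> is a bijection modulo \<open>2 h\<close>, and \<open>\<Phi>\<close> is its inverse.\<close>

subsection \<open>Reflections and the Weyl group\<close>

lemma root_reflection_eq:
  assumes "a \<bullet> a = 2"
  shows "root_reflection a v = v - (v \<bullet> a) *\<^sub>R a"
  using assms by (simp add: root_reflection_def)

lemma linear_root_reflection: "linear (root_reflection a)"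
  unfolding root_reflection_def
  by (rule linearI) (simp_all add: inner_add_left algebra_simps add_divide_distrib)

lemma root_reflection_involution: "root_reflection a (root_reflection a x) = x"
  by (cases "a = 0") (simp_all add: root_reflection_def algebra_simps inner_diff_left)

lemma weyl_group_linear: "w \<in> weyl_group R \<Longrightarrow> linear w"
proof (induction rule: weyl_group.induct)
  case (step w a)
  then show ?case using linear_compose linear_root_reflection by blast
qed (simp add: id_def linear_ident)

lemma weyl_group_bij: "w \<in> weyl_group R \<Longrightarrow> bij w"
proof (induction rule: weyl_group.induct)
  case (step w a)
  have "bij (root_reflection a)"
    by (rule involuntory_imp_bij) (rule root_reflection_involution)
  then show ?case using step bij_comp by blast
qed (rule bij_id)

lemma weyl_group_comp: "u \<in> weyl_group R \<Longrightarrow> w \<in> weyl_group R \<Longrightarrow> u \<circ> w \<in> weyl_group R"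
  by (induction rule: weyl_group.induct) (simp_all add: comp_assoc weyl_group.step)

lemma weyl_group_reflection: "a \<in> R \<Longrightarrow> root_reflection a \<in> weyl_group R"
  using weyl_group.step[OF weyl_group.id] by fastforce

lemma weyl_group_funpow: "w \<in> weyl_group R \<Longrightarrow> w ^^ n \<in> weyl_group R"
  by (induction n) (auto intro: weyl_group_comp weyl_group.id)

lemma weyl_group_reflection_product:
  "set as \<subseteq> R \<Longrightarrow> reflection_product as \<in> weyl_group R"
  by (induction as) (auto simp: reflection_product_def intro: weyl_group.intros)

lemma weyl_group_root:
  assumes "root_system R" "w \<in> weyl_group R" "x \<in> R"
  shows "w x \<in> R"
  using assms(2,3)
  by (induction arbitrary: x rule: weyl_group.induct) (use assms(1) in \<open>auto simp: root_system_def\<close>)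

lemma weyl_group_image_roots:
  assumes "root_system R" "w \<in> weyl_group R"
  shows "w ` R = R"
proof -
  have "finite R" using assms by (simp add: root_system_def)
  moreover have "inj_on w R" using weyl_group_bij[OF assms(2)] by (auto simp: bij_def inj_on_def)
  ultimately show ?thesis using weyl_group_root[OF assms] by (intro endo_inj_surj) auto
qed

lemma simple_root_system_weyl:
  assumes R: "root_system R" and P: "simple_root_system R P" and w: "w \<in> weyl_group R"
  shows "simple_root_system R (w ` P)"
proof -
  have lin: "linear w" and bij: "bij w" using weyl_group_linear weyl_group_bij w by auto
  have inj: "inj w" using bij by (simp add: bij_def)
  have "\<exists>c :: 'a \<Rightarrow> int. b = (\<Sum>a\<in>w ` P. of_int (c a) *\<^sub>R a) \<and>
      ((\<forall>a\<in>w ` P. c a \<ge> 0) \<or> (\<forall>a\<in>w ` P. c a \<le> 0))" if "b \<in> R" for b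
  proof -
    obtain b' where b': "b' \<in> R" "b = w b'" using weyl_group_image_roots[OF R w] \<open>b \<in> R\<close> by blast
    obtain c :: "'a \<Rightarrow> int" where c: "b' = (\<Sum>a\<in>P. of_int (c a) *\<^sub>R a)"
      "(\<forall>a\<in>P. c a \<ge> 0) \<or> (\<forall>a\<in>P. c a \<le> 0)"
      using P b'(1) unfolding simple_root_system_def by meson
    have inv: "inv w (w x) = x" for x using inj by simp
    have "b = (\<Sum>a\<in>P. of_int (c a) *\<^sub>R w a)"
      unfolding b'(2) c(1) by (simp add: linear_sum[OF lin] linear_cmul[OF lin])
    also have "\<dots> = (\<Sum>a\<in>w ` P. of_int ((c \<circ> inv w) a) *\<^sub>R a)"
      using inj by (subst sum.reindex) (auto simp: inv inj_on_def)
    finally show ?thesis using c(2) inv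
      by (intro exI[of _ "c \<circ> inv w"]) auto
  qed
  moreover have "w ` P \<subseteq> R" using P weyl_group_image_roots[OF R w]
    by (auto simp: simple_root_system_def)
  moreover have "independent (w ` P)"
    using P inj linear_independent_injective_image[OF lin] by (simp add: simple_root_system_def)
  moreover have "span (w ` P) = UNIV"
    using P bij linear_span_image[OF lin, of P] by (simp add: simple_root_system_def bij_def)
  ultimately show ?thesis by (simp add: simple_root_system_def)
qed

subsection \<open>Simply-laced simple systems\<close>

text \<open>The diagonal terms of the quadratic form are twice squares and the cross terms occur in
  pairs. Hence the root lattice is even, which \<open>root_split\<close> exploits.\<close>

lemma even_inner_integer_combination:
  fixes f :: "'b \<Rightarrow> 'a::real_inner" and c :: "'b \<Rightarrow> int"
  assumes "finite S"
    and "\<And>i. i \<in> S \<Longrightarrow> f i \<bullet> f i = 2"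
    and "\<And>i j. i \<in> S \<Longrightarrow> j \<in> S \<Longrightarrow> f i \<bullet> f j \<in> \<int>"
  shows "\<exists>k::int. (\<Sum>i\<in>S. of_int (c i) *\<^sub>R f i) \<bullet> (\<Sum>i\<in>S. of_int (c i) *\<^sub>R f i) = 2 * of_int k"
  using assms
proof (induction S)
  case (insert i S)
  let ?s = "\<Sum>i\<in>S. of_int (c i) *\<^sub>R f i"
  obtain k where k: "?s \<bullet> ?s = 2 * of_int k" using insert by blast
  have "f i \<bullet> ?s \<in> \<int>"
    using insert.prems by (auto simp: inner_sum_right intro!: Ints_sum Ints_mult)
  then obtain l where l: "f i \<bullet> ?s = of_int l" by (auto elim: Ints_cases)
  have "(\<Sum>i\<in>insert i S. of_int (c i) *\<^sub>R f i) \<bullet> (\<Sum>i\<in>insert i S. of_int (c i) *\<^sub>R f i)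
      = 2 * of_int (k + c i * l + c i * c i)"
    using insert.hyps insert.prems(1)[of i] k l
    by (simp add: inner_add_left inner_add_right inner_commute[of ?s "f i"] algebra_simps)
  then show ?case by blast
qed (intro exI[of _ 0], simp)

text \<open>Only one labelled simple system is fixed here. The equivariance of the labelling across
  simple systems enters later, through the assumption \<open>stabilizer\<close> of
  \<open>coxeter_phase\<close>.\<close>

locale simply_laced_base =
  fixes R P :: "'a::euclidean_space set" and I :: "'i set" and a :: "'i \<Rightarrow> 'a"
  assumes root_sys: "root_system R"
    and irreducible: "irreducible_root_system R"
    and laced: "simply_laced R"
    and base: "simple_root_system R P"
    and labelling: "bij_betw a I P"
begin

definition neighbours :: "'i \<Rightarrow> 'i set" where
  "neighbours i = {j. dynkin_edge I a i j}"

lemma finite_roots: "finite R"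
  using root_sys by (simp add: root_system_def)

lemma norm_root: "x \<in> R \<Longrightarrow> x \<bullet> x = 2"
  using laced by (simp add: simply_laced_def)

lemma inner_roots_Ints: "x \<in> R \<Longrightarrow> y \<in> R \<Longrightarrow> x \<bullet> y \<in> \<int>"
  using root_sys norm_root by (force simp: root_system_def)

lemma reflect_root: "x \<in> R \<Longrightarrow> y \<in> R \<Longrightarrow> y - (y \<bullet> x) *\<^sub>R x \<in> R"
  using root_sys norm_root root_reflection_eq unfolding root_system_def by metis

lemma base_image: "a ` I = P"
  using labelling by (simp add: bij_betw_def)

lemma inj_a: "inj_on a I"
  using labelling by (simp add: bij_betw_def)

lemma finite_I [simp]: "finite I"
proof -
  have "finite P" using base finite_roots finite_subset by (auto simp: simple_root_system_def)
  then show ?thesis using labelling bij_betw_finite by blast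
qed

lemma a_root: "i \<in> I \<Longrightarrow> a i \<in> R"
  using base base_image by (auto simp: simple_root_system_def)

lemma norm_a: "i \<in> I \<Longrightarrow> a i \<bullet> a i = 2"
  using a_root norm_root by blast

section \<open>Coordinates with respect to the simple roots\<close>

lemma a_indep:
  assumes "(\<Sum>i\<in>I. c i *\<^sub>R a i) = 0" "i \<in> I"
  shows "c i = 0"
proof -
  have ind: "independent P" "finite P"
    using base finite_roots finite_subset by (auto simp: simple_root_system_def)
  have inv: "inv_into I a (a j) = j" if "j \<in> I" for j using inj_a that by simp
  have sum0: "(\<Sum>x\<in>P. (c (inv_into I a x)) *\<^sub>R x) = 0"
    unfolding base_image[symmetric] using assms(1) inj_a
    by (subst sum.reindex) (auto simp: inv intro: trans[OF sum.cong])
  have "\<And>u. (\<Sum>x\<in>P. u x *\<^sub>R x) = 0 \<Longrightarrow> \<forall>x\<in>P. u x = 0"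
    using ind by (auto simp: independent_explicit)
  from this[OF sum0] have "\<forall>x\<in>P. c (inv_into I a x) = 0" .
  then show ?thesis using assms(2) inv base_image by force
qed

lemma a_linear_eq:
  assumes "linear f" "linear g" "\<And>i. i \<in> I \<Longrightarrow> f (a i) = g (a i)"
  shows "f = g"
proof
  fix x
  have "x \<in> span P" using base by (simp add: simple_root_system_def)
  then show "f x = g x"
    using linear_eq_on_span[OF assms(1,2), of P x] assms(3) base_image by auto
qed

lemma a_linear_extend: "\<exists>f::'a \<Rightarrow> 'b::real_vector. linear f \<and> (\<forall>i\<in>I. f (a i) = g i)"
proof -
  obtain f :: "'a \<Rightarrow> 'b" where f: "linear f" "\<forall>x\<in>P. f x = g (inv_into I a x)"
    using linear_independent_extend[of P "\<lambda>x. g (inv_into I a x)"] base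
    by (auto simp: simple_root_system_def)
  then show ?thesis using base_image inj_a by (intro exI[of _ f]) auto
qed

text \<open>The fundamental weights, that is, the basis dual to the simple roots; the inner product
  with \<open>\<omega> i\<close> reads off the coordinate at \<open>a i\<close>.\<close>

definition \<omega> :: "'i \<Rightarrow> 'a" where
  "\<omega> i = (SOME y. \<forall>j\<in>I. y \<bullet> a j = (if i = j then 1 else 0))"

lemma omega: "j \<in> I \<Longrightarrow> \<omega> i \<bullet> a j = (if i = j then 1 else 0)"
proof -
  obtain f :: "'a \<Rightarrow> real" where f: "linear f" "\<forall>j\<in>I. f (a j) = (if i = j then 1 else 0)"
    using a_linear_extend[of "\<lambda>j. if i = j then 1 else 0"] by auto
  \<comment> \<open>The vector representing the functional \<open>f\<close> is the image of 1 under
    its adjoint.\<close>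
  have "adjoint f 1 \<bullet> x = f x" for x
    using adjoint_clauses(2)[OF f(1), of 1 x] by simp
  then have "\<forall>j\<in>I. adjoint f 1 \<bullet> a j = (if i = j then 1 else 0)" using f(2) by simp
  then show "j \<in> I \<Longrightarrow> \<omega> i \<bullet> a j = (if i = j then 1 else 0)"
    unfolding \<omega>_def by (rule someI2) auto
qed

lemma omega_sum: "i \<in> I \<Longrightarrow> \<omega> i \<bullet> (\<Sum>j\<in>I. c j *\<^sub>R a j) = c i"
  by (simp add: inner_sum_right omega if_distrib[of "\<lambda>x. _ * x"] cong: if_cong)

lemma omega_expansion: "x = (\<Sum>i\<in>I. (\<omega> i \<bullet> x) *\<^sub>R a i)"
proof -
  have "linear (\<lambda>x. \<Sum>i\<in>I. (\<omega> i \<bullet> x) *\<^sub>R a i)"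
    by (intro linear_compose_sum ballI linearI) (simp_all add: inner_add_right scaleR_add_left)
  moreover have "a j = (\<Sum>i\<in>I. (\<omega> i \<bullet> a j) *\<^sub>R a i)" if "j \<in> I" for j
    using that by (simp add: omega if_distrib[of "\<lambda>x. x *\<^sub>R _"] sum.delta' cong: if_cong)
  ultimately have "(\<lambda>x. x) = (\<lambda>x. \<Sum>i\<in>I. (\<omega> i \<bullet> x) *\<^sub>R a i)"
    by (intro a_linear_eq linear_ident)
  then show ?thesis by (rule fun_cong)
qed

lemma omega_root_signs:
  assumes "x \<in> R"
  shows "(\<exists>c. \<forall>i\<in>I. \<omega> i \<bullet> x = of_int (c i)) \<and>
         ((\<forall>i\<in>I. \<omega> i \<bullet> x \<ge> 0) \<or> (\<forall>i\<in>I. \<omega> i \<bullet> x \<le> 0))"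
proof -
  obtain c :: "'a \<Rightarrow> int" where c: "x = (\<Sum>b\<in>P. of_int (c b) *\<^sub>R b)"
    "(\<forall>b\<in>P. c b \<ge> 0) \<or> (\<forall>b\<in>P. c b \<le> 0)"
    using assms base unfolding simple_root_system_def by meson
  have "x = (\<Sum>i\<in>I. of_int (c (a i)) *\<^sub>R a i)"
    unfolding c(1) base_image[symmetric] using inj_a by (subst sum.reindex) auto
  then have "\<forall>i\<in>I. \<omega> i \<bullet> x = of_int (c (a i))" using omega_sum by simp
  moreover have "a i \<in> P" if "i \<in> I" for i using base_image that by blast
  ultimately show ?thesis using c(2)
    by (intro conjI exI[of _ "\<lambda>i. c (a i)"]) auto
qed

text \<open>Cauchy-Schwarz is strict for two independent vectors of squared length 2, so the
  integral inner product is -1, 0 or 1. The value 1 would make \<open>a i - a j\<close> a root with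
  coefficients of both signs.\<close>

lemma inner_a_cases:
  assumes "i \<in> I" "j \<in> I" "i \<noteq> j"
  shows "a i \<bullet> a j = 0 \<or> a i \<bullet> a j = -1"
proof -
  obtain k :: int where k: "a i \<bullet> a j = of_int k"
    using inner_roots_Ints[OF a_root a_root] assms Ints_cases by metis
  have ne: "a i \<noteq> c *\<^sub>R a j" for c
  proof
    assume "a i = c *\<^sub>R a j"
    then have "\<omega> i \<bullet> a i = c * (\<omega> i \<bullet> a j)" by simp
    then show False using assms omega by simp
  qed
  have "\<bar>a i \<bullet> a j\<bar> \<noteq> norm (a i) * norm (a j)" 
  proof
    assume "\<bar>a i \<bullet> a j\<bar> = norm (a i) * norm (a j)"
    moreover have "norm (a i) = norm (a j)" "norm (a j) \<noteq> 0"
      using assms norm_a by (auto simp: norm_eq_sqrt_inner)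
    ultimately have "a j = a i \<or> norm (a j) *\<^sub>R a j = norm (a j) *\<^sub>R - a i"
      unfolding norm_cauchy_schwarz_abs_eq by auto
    then have "a i = 1 *\<^sub>R a j \<or> a i = (-1) *\<^sub>R a j"
      using \<open>norm (a j) \<noteq> 0\<close> unfolding scaleR_cancel_left by auto
    then show False using ne by blast
  qed
  then have "\<bar>a i \<bullet> a j\<bar> < norm (a i) * norm (a j)"
    using Cauchy_Schwarz_ineq2[of "a i" "a j"] by linarith
  moreover have "norm (a i) * norm (a j) = 2"
    using assms norm_a by (simp add: norm_eq_sqrt_inner)
  ultimately have "k = 0 \<or> k = 1 \<or> k = -1" using k by linarith
  moreover have "k \<noteq> 1"
  proof
    assume "k = 1"
    then have "a i - a j \<in> R" using reflect_root[OF a_root a_root, of j i] k assms by simp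
    then have "(\<forall>l\<in>I. \<omega> l \<bullet> (a i - a j) \<ge> 0) \<or> (\<forall>l\<in>I. \<omega> l \<bullet> (a i - a j) \<le> 0)"
      using omega_root_signs by blast
    moreover have "\<omega> i \<bullet> (a i - a j) = 1" "\<omega> j \<bullet> (a i - a j) = -1"
      using assms omega by (simp_all add: inner_diff_right)
    ultimately show False using assms by force
  qed
  ultimately show ?thesis using k by auto
qed

section \<open>Combinatorics of the Dynkin diagram\<close>

lemma dynkin_edge_sym: "dynkin_edge I a i j \<Longrightarrow> dynkin_edge I a j i"
  by (auto simp: dynkin_edge_def inner_commute)

lemma inner_a: "i \<in> I \<Longrightarrow> j \<in> I \<Longrightarrow> a i \<bullet> a j =
    (if i = j then 2 else if j \<in> neighbours i then -1 else 0)"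
  using inner_a_cases[of i j] norm_a[of i] by (auto simp: neighbours_def dynkin_edge_def)

lemma neighbours_subset: "neighbours i \<subseteq> I"
  by (auto simp: neighbours_def dynkin_edge_def)

lemma finite_neighbours [simp]: "finite (neighbours i)"
  using neighbours_subset finite_I by (rule finite_subset)

lemma neighbours_sym: "j \<in> neighbours i \<longleftrightarrow> i \<in> neighbours j"
  using dynkin_edge_sym by (auto simp: neighbours_def)

lemma neighbours_irrefl [simp]: "i \<notin> neighbours i"
  by (auto simp: neighbours_def dynkin_edge_def)

lemma neighbours_in_I: "j \<in> neighbours i \<Longrightarrow> i \<in> I" "j \<in> neighbours i \<Longrightarrow> j \<in> I"
  by (auto simp: neighbours_def dynkin_edge_def)

lemma inner_a_sum:
  assumes "i \<in> I" "T \<subseteq> I"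
  shows "a i \<bullet> (\<Sum>j\<in>T. c j *\<^sub>R a j) = (if i \<in> T then 2 * c i else 0) - (\<Sum>j\<in>neighbours i \<inter> T. c j)"
proof -
  have fin: "finite T" using assms(2) finite_I by (rule finite_subset)
  have "a i \<bullet> (\<Sum>j\<in>T. c j *\<^sub>R a j) = (\<Sum>j\<in>T. (if i = j then 2 * c j else 0) - (if j \<in> neighbours i then c j else 0))"
    unfolding inner_sum_right using assms by (intro sum.cong) (auto simp: inner_a)
  also have "\<dots> = (\<Sum>j\<in>T. if i = j then 2 * c j else 0) - (\<Sum>j\<in>neighbours i \<inter> T. c j)"
    using fin by (simp add: sum_subtractf Int_commute sum.inter_restrict)
  finally show ?thesis using fin by simp
qed

text \<open>The left side of the inequality's content is the squared length of the nonzero vector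
  obtained by adding the simple roots of \<open>T\<close>. Counting degrees, every nonempty full
  subgraph has fewer edges than vertices, so the diagram is a forest.\<close>

lemma sum_a_pos:
  assumes "T \<subseteq> I" "T \<noteq> {}"
  shows "(\<Sum>i\<in>T. 2 - real (card (neighbours i \<inter> T))) > 0"
proof -
  let ?x = "\<Sum>i\<in>T. 1 *\<^sub>R a i"
  have "?x = (\<Sum>i\<in>I. (if i \<in> T then 1 else 0) *\<^sub>R a i)"
    using assms(1) by (simp add: if_distrib[of "\<lambda>x. x *\<^sub>R _"] sum.inter_restrict[symmetric] Int_absorb1 cong: if_cong)
  then have "?x \<noteq> 0" using a_indep[of "\<lambda>i. if i \<in> T then 1 else 0"] assms by (metis (no_types, lifting) ex_in_conv one_neq_zero subsetD)
  then have "?x \<bullet> ?x > 0" by simp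
  also have "?x \<bullet> ?x = (\<Sum>i\<in>T. a i \<bullet> ?x)" by (simp add: inner_sum_left)
  also have "\<dots> = (\<Sum>i\<in>T. 2 - real (card (neighbours i \<inter> T)))"
    using assms(1) inner_a_sum[of _ T "\<lambda>_. 1"] by (intro sum.cong) auto
  finally show ?thesis .
qed

text \<open>By \<open>sum_a_pos\<close> the average degree in the full subgraph on \<open>T\<close>
  is below 2.\<close>

lemma leaf_exists:
  assumes "T \<subseteq> I" "T \<noteq> {}"
  obtains i where "i \<in> T" "card (neighbours i \<inter> T) \<le> 1"
proof -
  have "\<exists>i\<in>T. 2 - real (card (neighbours i \<inter> T)) > 0"
    using sum_a_pos[OF assms] sum_nonpos[of T "\<lambda>i. 2 - real (card (neighbours i \<inter> T))"] by fastforce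
  then show ?thesis using that by force
qed

lemma inner_split:
  assumes J: "J \<subseteq> I" and sep: "\<And>j k. j \<in> J \<Longrightarrow> k \<in> I - J \<Longrightarrow> k \<notin> neighbours j"
  shows "(\<Sum>j\<in>J. c j *\<^sub>R a j) \<bullet> (\<Sum>k\<in>I - J. d k *\<^sub>R a k) = 0"
proof -
  have "a j \<bullet> a k = 0" if "j \<in> J" "k \<in> I - J" for j k
    using sep[OF that] that J inner_a[of j k] by auto
  then show ?thesis by (simp add: inner_sum_left inner_sum_right)
qed

text \<open>The root lattice is even, so a root cannot split into two nonzero orthogonal
  lattice vectors.\<close>

lemma root_split:
  assumes J: "J \<subseteq> I" and sep: "\<And>j k. j \<in> J \<Longrightarrow> k \<in> I - J \<Longrightarrow> k \<notin> neighbours j"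
    and x: "x \<in> R"
  shows "(\<forall>i\<in>J. \<omega> i \<bullet> x = 0) \<or> (\<forall>i\<in>I - J. \<omega> i \<bullet> x = 0)"
proof -
  obtain c :: "'i \<Rightarrow> int" where c: "\<forall>i\<in>I. \<omega> i \<bullet> x = of_int (c i)"
    using omega_root_signs[OF x] by blast
  define y where "y = (\<Sum>j\<in>J. of_int (c j) *\<^sub>R a j)"
  define z where "z = (\<Sum>j\<in>I - J. of_int (c j) *\<^sub>R a j)"
  have "x = (\<Sum>j\<in>I. of_int (c j) *\<^sub>R a j)"
    using omega_expansion[of x] c by (metis (no_types, lifting) sum.cong)
  then have xyz: "x = y + z"
    using sum.subset_diff[OF J finite_I, of "\<lambda>j. of_int (c j) *\<^sub>R a j"] by (simp add: y_def z_def)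
  have "y \<bullet> z = 0" unfolding y_def z_def using J sep by (rule inner_split)
  then have "y \<bullet> y + z \<bullet> z = 2"
    using norm_root[OF x] by (simp add: xyz inner_add_left inner_add_right inner_commute)
  moreover have "\<exists>k::int. y \<bullet> y = 2 * of_int k" "\<exists>k::int. z \<bullet> z = 2 * of_int k"
    unfolding y_def z_def using J finite_subset[OF J finite_I] 
    by (auto intro!: even_inner_integer_combination inner_roots_Ints a_root norm_a)
  then obtain k l :: int where kl: "y \<bullet> y = 2 * of_int k" "z \<bullet> z = 2 * of_int l" by blast
  moreover have "y \<bullet> y \<ge> 0" "z \<bullet> z \<ge> 0" by simp_all
  ultimately have "of_int (k + l) = (1::real)" "k \<ge> 0" "l \<ge> 0" by auto
  then have "k = 0 \<or> l = 0" by linarith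
  then have "y = 0 \<or> z = 0" using kl by auto
  moreover have "c j = 0" if "y = 0" "j \<in> J" for j
  proof -
    have "y = (\<Sum>i\<in>I. (if i \<in> J then of_int (c i) else 0) *\<^sub>R a i)"
      using J by (simp add: y_def if_distrib[of "\<lambda>x. x *\<^sub>R _"] sum.inter_restrict[symmetric] Int_absorb1 cong: if_cong)
    then show ?thesis using a_indep[of "\<lambda>i. if i \<in> J then of_int (c i) else 0" j] that J by auto
  qed
  moreover have "c j = 0" if "z = 0" "j \<in> I - J" for j
  proof -
    have "I - J = I \<inter> {i. i \<notin> J}" by auto
    then have "z = (\<Sum>i\<in>I. (if i \<notin> J then of_int (c i) else 0) *\<^sub>R a i)"
      using sum.inter_restrict[OF finite_I, of "\<lambda>i. of_int (c i) *\<^sub>R a i" "{i. i \<notin> J}"]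
      by (simp add: z_def if_distrib[of "\<lambda>x. x *\<^sub>R _"] cong: if_cong)
    then show ?thesis using a_indep[of "\<lambda>i. if i \<notin> J then of_int (c i) else 0" j] that J by auto
  qed
  ultimately show ?thesis using c J by fastforce
qed

text \<open>By \<open>root_split\<close> every root is supported either on the component
  \<open>J\<close> of \<open>i\<close> or off it. Roots of the two kinds are orthogonal, so a vertex
  outside \<open>J\<close> would contradict irreducibility.\<close>

lemma dynkin_connected:
  assumes "i \<in> I" "k \<in> I"
  shows "(dynkin_edge I a)\<^sup>*\<^sup>* i k"
proof (rule ccontr)
  assume not: "\<not> (dynkin_edge I a)\<^sup>*\<^sup>* i k"
  define J where "J = {j\<in>I. (dynkin_edge I a)\<^sup>*\<^sup>* i j}"
  have J: "J \<subseteq> I" by (auto simp: J_def)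
  have sep: "l \<notin> neighbours j" if "j \<in> J" "l \<in> I - J" for j l
    using that by (auto simp: J_def neighbours_def intro: rtranclp.rtrancl_into_rtrancl)
  define A where "A = {x\<in>R. \<forall>j\<in>I - J. \<omega> j \<bullet> x = 0}"
  define B where "B = {x\<in>R. \<forall>j\<in>J. \<omega> j \<bullet> x = 0}"
  have "a i \<in> A" using assms omega a_root by (auto simp: A_def J_def)
  moreover have "a k \<in> B" using assms omega a_root not by (auto simp: B_def J_def)
  moreover have "A \<union> B = R" using root_split[OF J sep] by (auto simp: A_def B_def)
  moreover have "A \<inter> B = {}"
  proof -
    have "x = 0" if "x \<in> A \<inter> B" for x
      using that by (subst omega_expansion) (auto simp: A_def B_def intro!: sum.neutral)
    then show ?thesis using root_sys by (auto simp: root_system_def A_def)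
  qed
  moreover have "x \<bullet> y = 0" if "x \<in> A" "y \<in> B" for x y
  proof -
    have "x = (\<Sum>j\<in>J. (\<omega> j \<bullet> x) *\<^sub>R a j)"
      by (rule trans[OF omega_expansion], subst sum.subset_diff[OF J finite_I])
        (use that in \<open>auto simp: A_def\<close>)
    moreover have "y = (\<Sum>j\<in>I - J. (\<omega> j \<bullet> y) *\<^sub>R a j)"
      by (rule trans[OF omega_expansion], subst sum.subset_diff[OF J finite_I])
        (use that in \<open>auto simp: B_def\<close>)
    ultimately have "x \<bullet> y = (\<Sum>j\<in>J. (\<omega> j \<bullet> x) *\<^sub>R a j) \<bullet> (\<Sum>j\<in>I - J. (\<omega> j \<bullet> y) *\<^sub>R a j)"
      by (rule arg_cong2)
    also have "\<dots> = 0" using J sep by (rule inner_split)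
    finally show ?thesis .
  qed
  ultimately have "A \<noteq> {} \<and> B \<noteq> {} \<and> A \<inter> B = {} \<and> A \<union> B = R \<and> (\<forall>x\<in>A. \<forall>y\<in>B. x \<bullet> y = 0)"
    by auto
  then show False using irreducible unfolding irreducible_root_system_def by metis
qed

text \<open>The Perron vector is the minimiser of the inner product over the unit sphere of
  the coordinates with respect to the simple roots; since the off-diagonal inner products are
  nonpositive, its coordinates may be replaced by their absolute values.\<close>

lemma perron_vector:
  assumes "I \<noteq> {}"
  shows "\<exists>v (t::real). (\<forall>i\<in>I. v i > 0) \<and> 0 \<le> t \<and> t < 2 \<and>
    (\<forall>i\<in>I. (\<Sum>j\<in>neighbours i. v j) = t * v i)"
proof -
  define q where "q y = (\<Sum>i\<in>I. (\<omega> i \<bullet> y)\<^sup>2)" for y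
  define K where "K = {y. q y = 1}"
  have "compact K"
  proof -
    have "norm y \<le> (\<Sum>i\<in>I. norm (a i))" if "y \<in> K" for y
    proof -
      have "norm y \<le> (\<Sum>i\<in>I. norm ((\<omega> i \<bullet> y) *\<^sub>R a i))"
        by (subst omega_expansion) (rule norm_sum)
      also have "\<dots> \<le> (\<Sum>i\<in>I. norm (a i))"
      proof (rule sum_mono)
        fix i assume "i \<in> I"
        then have "(\<omega> i \<bullet> y)\<^sup>2 \<le> q y" unfolding q_def by (intro member_le_sum) auto
        then have "\<bar>\<omega> i \<bullet> y\<bar> \<le> 1" using that by (simp add: K_def abs_square_le_1)
        then show "norm ((\<omega> i \<bullet> y) *\<^sub>R a i) \<le> norm (a i)" by (simp add: mult_left_le_one_le)
      qed
      finally show ?thesis .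
    qed
    then have "bounded K" by (auto simp: bounded_iff)
    moreover have "closed K" unfolding K_def q_def
      by (intro closed_Collect_eq continuous_intros)
    ultimately show ?thesis by (simp add: compact_eq_bounded_closed)
  qed
  moreover have "K \<noteq> {}"
  proof -
    obtain i where "i \<in> I" using assms by blast
    then have "q (a i) = 1" by (simp add: q_def omega if_distrib[of "\<lambda>x. x\<^sup>2"] cong: if_cong)
    then show ?thesis by (auto simp: K_def)
  qed
  moreover have "continuous_on K (\<lambda>y. y \<bullet> y)" by (intro continuous_intros)
  ultimately obtain y0 where y0: "y0 \<in> K" "\<And>y. y \<in> K \<Longrightarrow> y0 \<bullet> y0 \<le> y \<bullet> y"
    using continuous_attains_inf[of K "\<lambda>y. y \<bullet> y"] by blast
  define v where "v i = \<bar>\<omega> i \<bullet> y0\<bar>" for i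
  define y where "y = (\<Sum>i\<in>I. v i *\<^sub>R a i)"
  define \<mu> where "\<mu> = y0 \<bullet> y0"
  have vy: "\<omega> i \<bullet> y = v i" if "i \<in> I" for i using that by (simp add: y_def omega_sum)
  have qy: "q y = 1" using y0(1) by (simp add: q_def vy K_def v_def)
  have dbl: "(\<Sum>i\<in>I. c i *\<^sub>R a i) \<bullet> (\<Sum>i\<in>I. c i *\<^sub>R a i) = (\<Sum>i\<in>I. \<Sum>j\<in>I. c i * c j * (a i \<bullet> a j))" for c
    unfolding inner_sum_left by (simp add: inner_sum_right sum_distrib_left ac_simps)
  have "y \<bullet> y \<le> y0 \<bullet> y0"
  proof -
    have "y \<bullet> y = (\<Sum>i\<in>I. \<Sum>j\<in>I. v i * v j * (a i \<bullet> a j))" unfolding y_def by (rule dbl)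
    also have "\<dots> \<le> (\<Sum>i\<in>I. \<Sum>j\<in>I. (\<omega> i \<bullet> y0) * (\<omega> j \<bullet> y0) * (a i \<bullet> a j))"
    proof (intro sum_mono)
      fix i j assume ij: "i \<in> I" "j \<in> I"
      have "(\<omega> i \<bullet> y0) * (\<omega> j \<bullet> y0) \<le> v i * v j"
        unfolding v_def by (metis abs_ge_self abs_mult)
      moreover have "v i * v i = (\<omega> i \<bullet> y0) * (\<omega> i \<bullet> y0)" by (simp add: v_def)
      ultimately show "v i * v j * (a i \<bullet> a j) \<le> (\<omega> i \<bullet> y0) * (\<omega> j \<bullet> y0) * (a i \<bullet> a j)"
        using ij by (cases "i = j") (auto simp: inner_a)
    qed
    also have "\<dots> = y0 \<bullet> y0" using dbl[of "\<lambda>i. \<omega> i \<bullet> y0"] omega_expansion[of y0] by simp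
    finally show ?thesis .
  qed
  then have yy: "y \<bullet> y = \<mu>" using y0(2)[of y] qy by (simp add: K_def \<mu>_def)
  have y_ne: "y \<noteq> 0" using qy by (auto simp: q_def)
  then have mu_pos: "\<mu> > 0" using yy by (metis inner_gt_zero_iff)
  have min: "\<mu> * q z \<le> z \<bullet> z" for z
  proof (cases "q z = 0")
    case True then show ?thesis by simp
  next
    case False
    then have "q z > 0" by (simp add: q_def sum_nonneg order_less_le)
    define t where "t = 1 / sqrt (q z)"
    have t2: "t * t = 1 / q z" using \<open>q z > 0\<close> by (simp add: t_def field_simps)
    have "q (t *\<^sub>R z) = t * t * q z"
      by (simp add: q_def sum_distrib_left power2_eq_square ac_simps)
    then have "t *\<^sub>R z \<in> K" using t2 \<open>q z > 0\<close> by (simp add: K_def)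
    then have "\<mu> \<le> (t *\<^sub>R z) \<bullet> (t *\<^sub>R z)" using y0(2) unfolding \<mu>_def by blast
    also have "\<dots> = (z \<bullet> z) / q z" using t2 by (simp add: mult.assoc[symmetric])
    finally show ?thesis using \<open>q z > 0\<close> by (simp add: field_simps)
  qed
  \<comment> \<open>Lagrange condition: moving \<open>y\<close> along \<open>a i\<close> changes
    \<open>z \<bullet> z - \<mu> * q z\<close> by a quadratic polynomial in \<open>t\<close> that is
    nonnegative for all \<open>t\<close>, so its linear coefficient vanishes.\<close>
  have eig: "a i \<bullet> y = \<mu> * v i" if i: "i \<in> I" for i
  proof -
    have ineq: "0 \<le> 2 * t * (a i \<bullet> y - \<mu> * v i) + t\<^sup>2 * (2 - \<mu>)" for t
    proof -
      have "q (y + t *\<^sub>R a i) = (\<Sum>j\<in>I. (v j)\<^sup>2 + (if j = i then 2 * t * v j + t\<^sup>2 else 0))"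
        unfolding q_def using i
        by (intro sum.cong) (auto simp: inner_add_right vy omega power2_eq_square algebra_simps)
      also have "\<dots> = 1 + (2 * t * v i + t\<^sup>2)"
        using qy i by (simp add: sum.distrib q_def vy)
      finally have "\<mu> * (1 + (2 * t * v i + t\<^sup>2)) \<le> (y + t *\<^sub>R a i) \<bullet> (y + t *\<^sub>R a i)"
        using min by metis
      also have "\<dots> = \<mu> + 2 * t * (a i \<bullet> y) + t\<^sup>2 * 2"
        using norm_a[OF i] yy by (simp add: inner_add_left inner_add_right inner_commute power2_eq_square)
      finally show ?thesis by (simp add: algebra_simps)
    qed
    define d where "d = a i \<bullet> y - \<mu> * v i"
    \<comment> \<open>A positive upper bound for the quadratic coefficient. At
      \<open>t = - d / e\<close> the polynomial is then at most \<open>- d\<^sup>2 / e\<close>,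
      which forces \<open>d = 0\<close>.\<close>
    define e where "e = 1 + \<bar>2 - \<mu>\<bar>"
    have e: "e > 0" "2 - \<mu> \<le> e" by (auto simp: e_def)
    have "0 \<le> 2 * (- d / e) * d + (- d / e)\<^sup>2 * (2 - \<mu>)" using ineq d_def by blast
    also have "\<dots> \<le> 2 * (- d / e) * d + (- d / e)\<^sup>2 * e" using e by (simp add: mult_left_mono)
    also have "\<dots> = - d\<^sup>2 / e" using e by (simp add: power2_eq_square field_simps)
    finally have "d\<^sup>2 \<le> 0" using e by (simp add: field_simps)
    then show ?thesis by (simp add: d_def)
  qed
  have nb: "(\<Sum>j\<in>neighbours i. v j) = (2 - \<mu>) * v i" if "i \<in> I" for i
  proof -
    have "neighbours i \<inter> I = neighbours i" using neighbours_subset by blast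
    then have "a i \<bullet> y = 2 * v i - (\<Sum>j\<in>neighbours i. v j)"
      unfolding y_def using inner_a_sum[OF that subset_refl, of v] that by simp
    then show ?thesis using eig[OF that] by (simp add: algebra_simps)
  qed
  have v_nonneg: "v i \<ge> 0" for i by (simp add: v_def)
  have v_pos: "v i > 0" if i: "i \<in> I" for i
  proof (rule ccontr)
    assume "\<not> v i > 0"
    then have v0: "v i = 0" using v_nonneg[of i] by simp
    \<comment> \<open>A zero coordinate spreads: the neighbouring coordinates are nonnegative and
      sum to 0. By connectedness all of \<open>y\<close> would vanish.\<close>
    have "v j = 0 \<and> j \<in> I" if "(dynkin_edge I a)\<^sup>*\<^sup>* i j" for j
      using that
    proof (induction rule: rtranclp_induct)
      case base then show ?case using v0 i by simp
    next
      case (step j k)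
      then have "(\<Sum>j\<in>neighbours j. v j) = 0" using nb by simp
      then have "\<forall>k\<in>neighbours j. v k = 0" using v_nonneg by (subst (asm) sum_nonneg_eq_0_iff) auto
      moreover have "k \<in> neighbours j" using step by (simp add: neighbours_def)
      ultimately show ?case using neighbours_subset by blast
    qed
    then have "\<forall>j\<in>I. v j = 0" using dynkin_connected[OF i] by blast
    then have "y = 0" by (simp add: y_def)
    then show False using y_ne by simp
  qed
  have "0 \<le> (2 - \<mu>)"
  proof -
    obtain i where i: "i \<in> I" using assms by blast
    have "0 \<le> (2 - \<mu>) * v i" using nb[OF i] v_nonneg sum_nonneg[of "neighbours i" v] by simp
    then show ?thesis using v_pos[OF i] by (simp add: zero_le_mult_iff)
  qed
  then show ?thesis using v_pos nb mu_pos by (intro exI[of _ v] exI[of _ "2 - \<mu>"]) auto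
qed

end

subsection \<open>Coxeter elements and orientations\<close>

text \<open>Positions in the list turn precedence into a comparison of natural numbers, which then
  serves as the measure for inductions along the expression.\<close>

lemma precedes_index:
  assumes "distinct js"
  obtains f :: "'i \<Rightarrow> nat" where "inj_on f (set js)"
    "\<And>i j. precedes js i j \<longleftrightarrow> i \<in> set js \<and> j \<in> set js \<and> f i < f j"
proof -
  define f where "f = inv_into {..<length js} ((!) js)"
  have inj: "inj_on ((!) js) {..<length js}" using assms by (auto simp: inj_on_def nth_eq_iff_index_eq)
  have f: "f (js ! k) = k" if "k < length js" for k
    unfolding f_def using inv_into_f_f[OF inj] that by simp
  have 1: "inj_on f (set js)" using f by (auto simp: inj_on_def in_set_conv_nth)
  have 2: "precedes js i j \<longleftrightarrow> i \<in> set js \<and> j \<in> set js \<and> f i < f j" for i j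
  proof
    assume "precedes js i j"
    then show "i \<in> set js \<and> j \<in> set js \<and> f i < f j" unfolding precedes_def using f by fastforce
  next
    assume "i \<in> set js \<and> j \<in> set js \<and> f i < f j"
    then show "precedes js i j" unfolding precedes_def using f by (metis in_set_conv_nth)
  qed
  show ?thesis using that[OF 1 2] .
qed

lemma precedes_snoc:
  assumes "distinct (js @ [i])"
  shows "precedes (js @ [i]) j k \<longleftrightarrow> (if k = i then j \<in> set js else precedes js j k)"
proof (cases "k = i")
  case True
  have "precedes (js @ [i]) j i \<longleftrightarrow> j \<in> set js"
  proof
    assume "precedes (js @ [i]) j i"
    then obtain l m where "l < m" "m < length (js @ [i])" "(js @ [i]) ! l = j"
      by (auto simp: precedes_def)
    then show "j \<in> set js" by (auto simp: nth_append)
  next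
    assume "j \<in> set js"
    then obtain l where "l < length js" "js ! l = j" by (auto simp: in_set_conv_nth)
    then show "precedes (js @ [i]) j i"
      unfolding precedes_def by (intro exI[of _ l] exI[of _ "length js"]) (simp add: nth_append)
  qed
  then show ?thesis using True by simp
next
  case False
  have "precedes (js @ [i]) j k \<longleftrightarrow> precedes js j k"
  proof
    assume "precedes (js @ [i]) j k"
    then obtain l m where lm: "l < m" "m < length (js @ [i])" "(js @ [i]) ! l = j" "(js @ [i]) ! m = k"
      by (auto simp: precedes_def)
    then have "m < length js" using False by (cases "m = length js") auto
    then show "precedes js j k"
      using lm unfolding precedes_def by (intro exI[of _ l] exI[of _ m]) (simp add: nth_append)
  next
    assume "precedes js j k"
    then obtain l m where "l < m" "m < length js" "js ! l = j" "js ! m = k"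
      by (auto simp: precedes_def)
    then show "precedes (js @ [i]) j k"
      unfolding precedes_def by (intro exI[of _ l] exI[of _ m]) (simp add: nth_append)
  qed
  then show ?thesis using False by simp
qed

lemma reflection_product_snoc:
  "reflection_product (as @ [b]) = reflection_product as \<circ> root_reflection b"
  by (induction as) (simp_all add: reflection_product_def comp_assoc)

context simply_laced_base
begin

text \<open>The vector \<open>b l\<close> is the image of \<open>a l\<close> under the product of
  the reflections standing before \<open>l\<close>. Appending the reflection in \<open>a i\<close>
  subtracts \<open>x \<bullet> a i\<close> times such an image; the second clause is the first one
  for the prefix before \<open>i\<close>, applied to \<open>a i\<close>.\<close>

lemma reflection_product_expansion:
  assumes "set js \<subseteq> I" "distinct js"
  shows "\<exists>b. (\<forall>x. reflection_product (map a js) x = x - (\<Sum>l\<in>set js. (x \<bullet> a l) *\<^sub>R b l)) \<and>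
    (\<forall>i\<in>set js. b i = a i - (\<Sum>j | precedes js j i. (a i \<bullet> a j) *\<^sub>R b j))"
  using assms
proof (induction js rule: rev_induct)
  case Nil
  then show ?case by (simp add: reflection_product_def)
next
  case (snoc i js)
  let ?r = "reflection_product (map a js)"
  have "set js \<subseteq> I" "distinct js" using snoc.prems by auto
  from snoc.IH[OF this] obtain b where b: "\<forall>x. ?r x = x - (\<Sum>l\<in>set js. (x \<bullet> a l) *\<^sub>R b l)"
    "\<forall>i\<in>set js. b i = a i - (\<Sum>j | precedes js j i. (a i \<bullet> a j) *\<^sub>R b j)"
    by (elim exE conjE)
  have lin: "linear ?r" using snoc.prems a_root
    by (intro weyl_group_linear[of _ R] weyl_group_reflection_product) auto
  define b' where "b' = b(i := ?r (a i))"
  have i: "i \<in> I" "i \<notin> set js" using snoc.prems by auto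
  have b'_eq: "b' j = b j" if "j \<in> set js" for j using that i by (auto simp: b'_def)
  have s1: "(\<Sum>l\<in>set js. c l *\<^sub>R b' l) = (\<Sum>l\<in>set js. c l *\<^sub>R b l)" for c
    by (intro sum.cong) (auto simp: b'_eq)
  have "reflection_product (map a (js @ [i])) x = x - (\<Sum>l\<in>set (js @ [i]). (x \<bullet> a l) *\<^sub>R b' l)" for x
  proof -
    have "reflection_product (map a (js @ [i])) x = ?r (x - (x \<bullet> a i) *\<^sub>R a i)"
      using norm_a[OF i(1)] by (simp add: reflection_product_snoc root_reflection_eq)
    also have "\<dots> = ?r x - (x \<bullet> a i) *\<^sub>R ?r (a i)"
      by (simp add: linear_diff[OF lin] linear_cmul[OF lin])
    also have "\<dots> = x - (\<Sum>l\<in>set (js @ [i]). (x \<bullet> a l) *\<^sub>R b' l)"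
      using b(1) i(2) s1 by (simp add: b'_def)
    finally show ?thesis .
  qed
  moreover have "b' k = a k - (\<Sum>j | precedes (js @ [i]) j k. (a k \<bullet> a j) *\<^sub>R b' j)"
    if "k \<in> set (js @ [i])" for k
  proof (cases "k = i")
    case True
    then have "{j. precedes (js @ [i]) j k} = set js"
      using precedes_snoc[OF snoc.prems(2)] by auto
    then show ?thesis using b(1) True s1 by (simp add: b'_def)
  next
    case False
    then have k: "k \<in> set js" using that by simp
    have "{j. precedes (js @ [i]) j k} = {j. precedes js j k}"
      using precedes_snoc[OF snoc.prems(2)] False by auto
    moreover have "(\<Sum>j | precedes js j k. (a k \<bullet> a j) *\<^sub>R b' j) = (\<Sum>j | precedes js j k. (a k \<bullet> a j) *\<^sub>R b j)"
      by (intro sum.cong) (auto simp: precedes_def intro!: b'_eq)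
    ultimately show ?thesis using b(2) k b'_eq by simp
  qed
  ultimately show ?case by blast
qed

end

locale coxeter_base = simply_laced_base R P I a
  for R P :: "'a::euclidean_space set" and I :: "'i set" and a :: "'i \<Rightarrow> 'a" +
  fixes C :: "'a \<Rightarrow> 'a"
  assumes compat: "compatible I a C"
begin

abbreviation arrow :: "'i \<Rightarrow> 'i \<Rightarrow> bool" where
  "arrow \<equiv> orientation I a C"

abbreviation \<beta> :: "'i \<Rightarrow> 'a" where
  "\<beta> \<equiv> beta_root I a C"

text \<open>\<open>cb l\<close> is the value of \<open>1 - C\<close> on the \<open>l\<close>-th fundamental weight; it is manifestly
  independent of the expression for \<open>C\<close> and turns out to be \<open>\<beta> l\<close>.\<close>

definition cb :: "'i \<Rightarrow> 'a" where
  "cb l = \<omega> l - C (\<omega> l)"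

text \<open>Evaluating the expansion of \<open>reflection_product_expansion\<close> at the
  fundamental weights identifies its vectors with \<open>cb\<close>. Distinct simple roots have
  inner product 0 or -1, so the recursion keeps exactly the earlier neighbours, with a plus
  sign.\<close>

lemma cb_expression:
  assumes "coxeter_expression I a C js"
  shows "C x = x - (\<Sum>l\<in>I. (x \<bullet> a l) *\<^sub>R cb l)"
    and "i \<in> I \<Longrightarrow> cb i = a i + (\<Sum>j | j \<in> neighbours i \<and> precedes js j i. cb j)"
proof -
  have js: "distinct js" "set js = I" "C = reflection_product (map a js)"
    using assms by (auto simp: coxeter_expression_def)
  obtain b where b: "\<And>x. C x = x - (\<Sum>l\<in>I. (x \<bullet> a l) *\<^sub>R b l)"
    "\<And>i. i \<in> I \<Longrightarrow> b i = a i - (\<Sum>j | precedes js j i. (a i \<bullet> a j) *\<^sub>R b j)"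
    using reflection_product_expansion[of js] js by auto
  have "cb l = b l" if "l \<in> I" for l
    unfolding cb_def b(1) using that
    by (simp add: omega if_distrib[of "\<lambda>x. x *\<^sub>R _"] cong: if_cong)
  note cb = this
  show "C x = x - (\<Sum>l\<in>I. (x \<bullet> a l) *\<^sub>R cb l)" using b(1) cb by simp
  assume i: "i \<in> I"
  have pre: "j \<in> I \<and> j \<noteq> i" if "precedes js j i" for j
    using that js by (auto simp: precedes_def nth_eq_iff_index_eq)
  then have "{j. precedes js j i} \<subseteq> I" by auto
  then have fin: "finite {j. precedes js j i}" using finite_I by (rule finite_subset)
  have "(\<Sum>j | precedes js j i. (a i \<bullet> a j) *\<^sub>R b j)
      = (\<Sum>j | precedes js j i. if j \<in> neighbours i then - cb j else 0)"
    using pre i cb by (intro sum.cong) (auto simp: inner_a)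
  also have "\<dots> = (\<Sum>j | j \<in> neighbours i \<and> precedes js j i. - cb j)"
    using fin by (subst sum.inter_filter[symmetric]) (auto intro!: sum.cong)
  finally show "cb i = a i + (\<Sum>j | j \<in> neighbours i \<and> precedes js j i. cb j)"
    using b(2)[OF i] cb[OF i] by (simp add: sum_negf)
qed

lemma C_expansion: "C x = x - (\<Sum>l\<in>I. (x \<bullet> a l) *\<^sub>R cb l)"
  using compat cb_expression(1) by (auto simp: compatible_def)

text \<open>Induction along the expression, unwinding the recursion for \<open>cb\<close>. For an
  edge between \<open>i\<close> and \<open>k\<close> the coordinate of \<open>cb i\<close> at
  \<open>k\<close> thus detects which of the two comes first, although \<open>cb\<close> itself does
  not refer to \<open>js\<close>.\<close>

lemma omega_cb:
  assumes js: "coxeter_expression I a C js" and "i \<in> I" "k \<in> I"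
  shows "\<omega> k \<bullet> cb i \<ge> 0" and "precedes js i k \<Longrightarrow> \<omega> k \<bullet> cb i = 0"
    and "\<omega> i \<bullet> cb i \<ge> 1"
    and "k \<in> neighbours i \<Longrightarrow> precedes js k i \<Longrightarrow> \<omega> k \<bullet> cb i \<ge> 1"
proof -
  have dist: "distinct js" "set js = I" using js by (auto simp: coxeter_expression_def)
  obtain f :: "'i \<Rightarrow> nat" where f: "inj_on f I"
    "\<And>i j. precedes js i j \<longleftrightarrow> i \<in> I \<and> j \<in> I \<and> f i < f j"
    using precedes_index[OF dist(1)] dist(2) by metis
  have step: "\<omega> k \<bullet> cb i = (if k = i then 1 else 0) + (\<Sum>j | j \<in> neighbours i \<and> precedes js j i. \<omega> k \<bullet> cb j)"
    if "i \<in> I" "k \<in> I" for i k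
    unfolding cb_expression(2)[OF js that(1)] using that by (simp add: inner_add_right inner_sum_right omega)
  have A: "(\<forall>k\<in>I. \<omega> k \<bullet> cb i \<ge> 0) \<and> (\<forall>k. precedes js i k \<longrightarrow> \<omega> k \<bullet> cb i = 0)" if "i \<in> I" for i
    using that
  proof (induction "f i" arbitrary: i rule: less_induct)
    case less
    then have "\<omega> k \<bullet> cb i \<ge> 0" if "k \<in> I" for k
      unfolding step[OF less.prems that] using that f(2) by (auto intro!: add_nonneg_nonneg sum_nonneg less.hyps[THEN conjunct1, rule_format])
    moreover have "\<omega> k \<bullet> cb i = 0" if "precedes js i k" for k
    proof -
      have k: "k \<in> I" "k \<noteq> i" "f i < f k" using that f(2) by auto
      have "\<omega> k \<bullet> cb j = 0" if "precedes js j i" for j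
        using less.hyps[of j] that k f(2) by auto
      then show ?thesis unfolding step[OF less.prems k(1)] using k(2) by (auto intro!: sum.neutral)
    qed
    ultimately show ?case by blast
  qed
  then show nn: "\<omega> k \<bullet> cb i \<ge> 0" and "precedes js i k \<Longrightarrow> \<omega> k \<bullet> cb i = 0"
    using assms by blast+
  have B: "\<omega> i \<bullet> cb i \<ge> 1" if "i \<in> I" for i
  proof -
    have "(\<Sum>j | j \<in> neighbours i \<and> precedes js j i. \<omega> i \<bullet> cb j) \<ge> 0"
      using A that neighbours_subset by (intro sum_nonneg) blast
    then show ?thesis using step[OF that that] by simp
  qed
  then show "\<omega> i \<bullet> cb i \<ge> 1" using assms by blast
  assume k: "k \<in> neighbours i" "precedes js k i"
  let ?S = "{j. j \<in> neighbours i \<and> precedes js j i}"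
  have "?S \<subseteq> neighbours i" by blast
  then have fin: "finite ?S" by (rule finite_subset) simp
  have "\<omega> k \<bullet> cb k \<le> (\<Sum>j\<in>?S. \<omega> k \<bullet> cb j)"
    using k A assms(3) neighbours_subset fin by (intro member_le_sum[of k ?S "\<lambda>j. \<omega> k \<bullet> cb j"]) blast+
  then show "\<omega> k \<bullet> cb i \<ge> 1" using B[OF assms(3)] step[OF assms(2,3)] k by auto
qed

text \<open>If two expressions ordered an edge differently, the same coordinate of
  \<open>cb j\<close> would be 0 and at least 1. Hence the existential quantifier in
  \<open>orientation\<close> may be resolved by any expression.\<close>

lemma arrow_iff:
  assumes js: "coxeter_expression I a C js"
  shows "arrow i j \<longleftrightarrow> j \<in> neighbours i \<and> precedes js i j"
proof
  assume "arrow i j"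
  then obtain js' where js': "coxeter_expression I a C js'" "precedes js' i j" and e: "dynkin_edge I a i j"
    by (auto simp: orientation_def)
  have ij: "i \<in> I" "j \<in> I" "i \<noteq> j" using e by (auto simp: dynkin_edge_def)
  have dist: "distinct js" "set js = I" using js by (auto simp: coxeter_expression_def)
  obtain f :: "'i \<Rightarrow> nat" where f: "inj_on f I"
    "\<And>i j. precedes js i j \<longleftrightarrow> i \<in> I \<and> j \<in> I \<and> f i < f j"
    using precedes_index[OF dist(1)] dist(2) by metis
  have "f i \<noteq> f j" using f(1) ij by (auto simp: inj_on_def)
  moreover have "\<not> precedes js j i"
  proof
    assume "precedes js j i"
    then have "\<omega> i \<bullet> cb j = 0" using omega_cb(2)[OF js ij(2,1)] by blast
    moreover have "\<omega> i \<bullet> cb j \<ge> 1"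
      using omega_cb(4)[OF js'(1) ij(2,1)] js'(2) e dynkin_edge_sym by (auto simp: neighbours_def)
    ultimately show False by simp
  qed
  ultimately show "j \<in> neighbours i \<and> precedes js i j"
    using f(2) ij e by (auto simp: neighbours_def)
next
  assume "j \<in> neighbours i \<and> precedes js i j"
  then show "arrow i j" using js by (auto simp: orientation_def neighbours_def)
qed

lemma arrow_index:
  obtains f :: "'i \<Rightarrow> nat" where "\<And>i j. arrow i j \<longleftrightarrow> j \<in> neighbours i \<and> f i < f j" "inj_on f I"
proof -
  obtain js where js: "coxeter_expression I a C js" using compat by (auto simp: compatible_def)
  then have dist: "distinct js" "set js = I" by (auto simp: coxeter_expression_def)
  obtain f :: "'i \<Rightarrow> nat" where f: "inj_on f I"
    "\<And>i j. precedes js i j \<longleftrightarrow> i \<in> I \<and> j \<in> I \<and> f i < f j"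
    using precedes_index[OF dist(1)] dist(2) by metis
  have "arrow i j \<longleftrightarrow> j \<in> neighbours i \<and> f i < f j" for i j
    using arrow_iff[OF js] f(2) neighbours_in_I by blast
  then show ?thesis using that f(1) by blast
qed

lemma arrow_cases: "j \<in> neighbours i \<Longrightarrow> arrow i j \<noteq> arrow j i"
proof -
  obtain f :: "'i \<Rightarrow> nat" where f: "\<And>i j. arrow i j \<longleftrightarrow> j \<in> neighbours i \<and> f i < f j" "inj_on f I"
    using arrow_index by blast
  assume j: "j \<in> neighbours i"
  then have "f i \<noteq> f j" using f(2) neighbours_in_I by (auto simp: inj_on_def) (metis neighbours_irrefl)
  then show ?thesis using f(1) j neighbours_sym[of i j] by force
qed

lemma arrow_neighbours: "arrow i j \<Longrightarrow> j \<in> neighbours i" "arrow i j \<Longrightarrow> i \<in> neighbours j"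
  using dynkin_edge_sym by (auto simp: orientation_def neighbours_def)

section \<open>The recursion for the roots \<open>\<beta> i\<close> and height functions\<close>

lemma cb_arrow: "i \<in> I \<Longrightarrow> cb i = a i + (\<Sum>j | arrow j i. cb j)"
proof -
  obtain js where js: "coxeter_expression I a C js" using compat by (auto simp: compatible_def)
  have "{j. j \<in> neighbours i \<and> precedes js j i} = {j. arrow j i}"
    using arrow_iff[OF js] neighbours_sym by blast
  then show "i \<in> I \<Longrightarrow> cb i = a i + (\<Sum>j | arrow j i. cb j)" using cb_expression(2)[OF js] by simp
qed

lemma finite_arrows [simp]: "finite {j. arrow j i}" "finite {j. arrow i j}"
  by (rule finite_subset[OF _ finite_neighbours[of i]], use arrow_neighbours in blast)+

lemma sum_neighbours_arrows:
  "(\<Sum>j\<in>neighbours i. g j) = (\<Sum>j | arrow i j. g j) + (\<Sum>j | arrow j i. g j)"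
proof -
  have "neighbours i = {j. arrow i j} \<union> {j. arrow j i}" "{j. arrow i j} \<inter> {j. arrow j i} = {}"
    using arrow_cases arrow_neighbours by blast+
  then show ?thesis by (simp add: sum.union_disjoint)
qed

lemma arrow_in_I: "arrow i j \<Longrightarrow> i \<in> I" "arrow i j \<Longrightarrow> j \<in> I"
  using arrow_neighbours neighbours_subset by blast+

lemma arrow_path_in_I: "arrow\<^sup>*\<^sup>* i j \<Longrightarrow> j \<in> I \<Longrightarrow> i \<in> I"
  by (metis arrow_in_I(1) converse_rtranclpE)

lemma arrow_path_index:
  assumes "\<And>i j. arrow i j \<Longrightarrow> f i < (f j :: nat)"
  shows "arrow\<^sup>*\<^sup>* i j \<Longrightarrow> f i \<le> f j"
  by (induction rule: rtranclp_induct) (use assms less_imp_le le_trans in blast)+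

text \<open>Two oriented paths from \<open>k\<close> to \<open>i\<close> would give a full subgraph with at least as many
  edges as vertices, contradicting positivity of the inner product on the sum of its simple roots.\<close>

lemma arrow_paths_disjoint:
  assumes ji: "arrow j i" "arrow j' i" "j \<noteq> j'" and k: "arrow\<^sup>*\<^sup>* k j" "arrow\<^sup>*\<^sup>* k j'"
  shows False
proof -
  obtain f :: "'i \<Rightarrow> nat" where f: "\<And>i j. arrow i j \<longleftrightarrow> j \<in> neighbours i \<and> f i < f j" "inj_on f I"
    using arrow_index by blast
  have path: "arrow\<^sup>*\<^sup>* l m \<Longrightarrow> f l \<le> f m" for l m
    by (rule arrow_path_index) (use f in auto)
  have ki: "k \<noteq> i" using path[OF k(1)] ji(1) f(1) by force
  define S where "S = {l. arrow\<^sup>*\<^sup>* k l \<and> arrow\<^sup>*\<^sup>* l i}"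
  have S: "S \<subseteq> I" using arrow_path_in_I arrow_in_I(2)[OF ji(1)] by (auto simp: S_def)
  then have fin: "finite S" using finite_I by (rule finite_subset)
  have kS: "k \<in> S" and iS: "i \<in> S" using k ji by (auto simp: S_def intro: rtranclp.rtrancl_into_rtrancl)
  define inn where "inn l = card {m\<in>S. arrow m l}" for l
  define out where "out l = card {m\<in>S. arrow l m}" for l
  have nb: "card (neighbours l \<inter> S) = inn l + out l" for l
  proof -
    have "neighbours l \<inter> S = {m\<in>S. arrow m l} \<union> {m\<in>S. arrow l m}"
      "{m\<in>S. arrow m l} \<inter> {m\<in>S. arrow l m} = {}"
      using arrow_cases arrow_neighbours by blast+
    then show ?thesis using fin by (simp add: inn_def out_def card_Un_disjoint)
  qed
  have card_sum: "card {m\<in>S. Q m} = (\<Sum>m\<in>S. if Q m then 1 else 0)" for Q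
    using fin by (simp add: sum.inter_filter[symmetric])
  have swap: "(\<Sum>l\<in>S. out l) = (\<Sum>l\<in>S. inn l)"
    unfolding inn_def out_def card_sum by (rule sum.swap)
  have "0 < (\<Sum>l\<in>S. 2 - real (card (neighbours l \<inter> S)))"
    using sum_a_pos[OF S] kS by blast
  also have "\<dots> = (\<Sum>l\<in>S. 2) - real (\<Sum>l\<in>S. inn l) - real (\<Sum>l\<in>S. out l)"
    by (simp add: nb sum_subtractf sum.distrib)
  also have "\<dots> = (\<Sum>l\<in>S. 2 - 2 * real (inn l))"
    unfolding swap by (simp add: sum_subtractf sum_distrib_left sum_negf)
  \<comment> \<open>Each vertex of \<open>S\<close> other than \<open>k\<close> has an incoming
    arrow from \<open>S\<close>, and \<open>i\<close> has at least two. The surplus at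
    \<open>i\<close> pays for the possible deficit at \<open>k\<close>.\<close>
  also have "\<dots> \<le> (\<Sum>l\<in>S. (if l = k then 2 else 0) - (if l = i then 2 else 0))"
  proof (rule sum_mono)
    fix l assume l: "l \<in> S"
    have "inn l \<ge> 1" if lk: "l \<noteq> k"
    proof -
      obtain m where m: "arrow\<^sup>*\<^sup>* k m" "arrow m l"
        using l lk by (auto simp: S_def elim: rtranclp.cases)
      then have "m \<in> {m\<in>S. arrow m l}" using l
        by (auto simp: S_def intro: converse_rtranclp_into_rtranclp)
      then have "inn l \<noteq> 0" unfolding inn_def using fin by auto
      then show ?thesis by simp
    qed
    moreover have "inn i \<ge> 2"
    proof -
      have "{j, j'} \<subseteq> {m\<in>S. arrow m i}" using k ji by (auto simp: S_def)
      then have "card {j, j'} \<le> inn i" unfolding inn_def using fin by (intro card_mono) auto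
      then show ?thesis using ji(3) by simp
    qed
    ultimately show "2 - 2 * real (inn l) \<le> (if l = k then 2 else 0) - (if l = i then 2 else 0)"
      using ki by auto
  qed
  also have "\<dots> = 0" using fin kS iS by (simp add: sum_subtractf)
  finally show False by simp
qed

text \<open>The vertices below \<open>i\<close>, apart from \<open>i\<close> itself, are the union
  of those below its direct predecessors. This union is disjoint by
  \<open>arrow_paths_disjoint\<close>.\<close>

lemma beta_recursion:
  assumes i: "i \<in> I"
  shows "\<beta> i = a i + (\<Sum>j | arrow j i. \<beta> j)"
proof -
  obtain f :: "'i \<Rightarrow> nat" where f: "\<And>i j. arrow i j \<longleftrightarrow> j \<in> neighbours i \<and> f i < f j" "inj_on f I"
    using arrow_index by blast
  define D where "D i = {j. j \<in> I \<and> arrow\<^sup>*\<^sup>* j i}" for i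
  have finD: "finite (D i)" for i by (simp add: D_def)
  have beta: "\<beta> i = (\<Sum>j\<in>D i. a j)" for i by (simp add: beta_root_def D_def)
  have "D i = insert i (\<Union>j\<in>{j. arrow j i}. D j)"
    using i by (auto simp: D_def intro: rtranclp.rtrancl_into_rtrancl elim: rtranclp.cases)
  moreover have "i \<notin> (\<Union>j\<in>{j. arrow j i}. D j)"
  proof
    assume "i \<in> (\<Union>j\<in>{j. arrow j i}. D j)"
    then obtain j where j: "arrow j i" "arrow\<^sup>*\<^sup>* i j" by (auto simp: D_def)
    have "f i \<le> f j" by (rule arrow_path_index[OF _ j(2)]) (use f in auto)
    then show False using j(1) f(1) by simp
  qed
  ultimately have "\<beta> i = a i + (\<Sum>j\<in>(\<Union>j\<in>{j. arrow j i}. D j). a j)"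
    unfolding beta by (simp add: finD)
  also have "(\<Sum>j\<in>(\<Union>j\<in>{j. arrow j i}. D j). a j) = (\<Sum>j | arrow j i. \<beta> j)"
    unfolding beta using arrow_paths_disjoint
    by (intro sum.UNION_disjoint) (auto simp: finD, auto simp: D_def)
  finally show ?thesis .
qed

text \<open>Both families satisfy the same recursion along arrows. Consequently
  \<open>C_expansion\<close> describes \<open>C\<close> through the roots
  \<open>\<beta> l\<close>.\<close>

lemma beta_eq_cb: "i \<in> I \<Longrightarrow> \<beta> i = cb i"
proof -
  obtain f :: "'i \<Rightarrow> nat" where f: "\<And>i j. arrow i j \<longleftrightarrow> j \<in> neighbours i \<and> f i < f j" "inj_on f I"
    using arrow_index by blast
  show "i \<in> I \<Longrightarrow> \<beta> i = cb i"
  proof (induction "f i" arbitrary: i rule: less_induct)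
    case less
    have "(\<Sum>j | arrow j i. \<beta> j) = (\<Sum>j | arrow j i. cb j)"
      using less.hyps f(1) arrow_in_I by (intro sum.cong) auto
    then show ?case using beta_recursion cb_arrow less.prems by simp
  qed
qed

text \<open>The diagram is a forest: remove a vertex with at most one neighbour in the remaining
  set, define the height on the rest by induction, and let the one remaining edge, if any, dictate
  the last value.\<close>

lemma height_exists:
  "\<exists>\<eta> :: 'i \<Rightarrow> int. \<forall>i j. arrow i j \<longrightarrow> \<eta> j = \<eta> i + 1"
proof -
  have "\<exists>\<eta> :: 'i \<Rightarrow> int. \<forall>i\<in>S. \<forall>j\<in>S. arrow i j \<longrightarrow> \<eta> j = \<eta> i + 1" if "S \<subseteq> I" for S
    using that
  proof (induction "card S" arbitrary: S rule: less_induct)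
    case less
    have fin: "finite S" using less.prems finite_I by (rule finite_subset)
    show ?case
    proof (cases "S = {}")
      case False
      obtain v where v: "v \<in> S" "card (neighbours v \<inter> S) \<le> 1"
        using leaf_exists[OF less.prems False] .
      have "card (S - {v}) < card S" using fin v(1) by (rule card_Diff1_less)
      moreover have "S - {v} \<subseteq> I" using less.prems by blast
      ultimately have "\<exists>\<eta> :: 'i \<Rightarrow> int. \<forall>i\<in>S - {v}. \<forall>j\<in>S - {v}. arrow i j \<longrightarrow> \<eta> j = \<eta> i + 1"
        by (rule less.hyps)
      then obtain \<eta> :: "'i \<Rightarrow> int" where \<eta>: "\<forall>i\<in>S - {v}. \<forall>j\<in>S - {v}. arrow i j \<longrightarrow> \<eta> j = \<eta> i + 1"
        by (elim exE)
      show ?thesis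
      proof (cases "neighbours v \<inter> S = {}")
        case True
        then have "\<not> arrow v j" "\<not> arrow j v" if "j \<in> S" for j
          using that arrow_neighbours by blast+
        then show ?thesis using \<eta> by (intro exI[of _ \<eta>]) blast
      next
        case False
        moreover have "finite (neighbours v \<inter> S)" using fin by simp
        ultimately have "card (neighbours v \<inter> S) \<noteq> 0" by simp
        then have "card (neighbours v \<inter> S) = 1" using v(2) by linarith
        then obtain u where u: "neighbours v \<inter> S = {u}" by (rule card_1_singletonE)
        have uv: "u \<noteq> v" using u by auto
        have only: "j = u" if "j \<in> S" "arrow v j \<or> arrow j v" for j
          using u that arrow_neighbours by blast
        have asym: "\<not> (arrow u v \<and> arrow v u)" using arrow_cases arrow_neighbours by blast
        define \<eta>' where "\<eta>' = \<eta>(v := if arrow u v then \<eta> u + 1 else \<eta> u - 1)"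
        have "\<eta>' j = \<eta>' i + 1" if ij: "i \<in> S" "j \<in> S" "arrow i j" for i j
        proof -
          consider "i = v" | "j = v" | "i \<noteq> v" "j \<noteq> v" by blast
          then show ?thesis
          proof cases
            case 1
            then have "j = u" using only ij by blast
            then show ?thesis using 1 ij asym uv by (auto simp: \<eta>'_def)
          next
            case 2
            then have "i = u" using only ij by blast
            then show ?thesis using 2 ij asym uv by (auto simp: \<eta>'_def)
          next
            case 3
            then show ?thesis using \<eta> ij by (auto simp: \<eta>'_def)
          qed
        qed
        then show ?thesis by blast
      qed
    qed simp
  qed
  from this[OF subset_refl] show ?thesis using arrow_in_I by meson
qed

section \<open>Finite order of the Coxeter element\<close>

lemma C_weyl: "C \<in> weyl_group R"
proof -
  obtain js where "set js = I" "C = reflection_product (map a js)"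
    using compat by (auto simp: compatible_def coxeter_expression_def)
  then show ?thesis using a_root weyl_group_reflection_product[of "map a js" R] by auto
qed

lemma linear_C: "linear C" and inj_C: "inj C" and C_root: "x \<in> R \<Longrightarrow> C x \<in> R"
  using C_weyl weyl_group_linear weyl_group_bij weyl_group_root[OF root_sys] by (auto simp: bij_def)

lemma C_pow_linear: "linear (C ^^ k)"
  using weyl_group_linear weyl_group_funpow C_weyl by blast

lemma C_pow_root: "x \<in> R \<Longrightarrow> (C ^^ k) x \<in> R"
  using weyl_group_root[OF root_sys] weyl_group_funpow C_weyl by blast

text \<open>Only finitely many self-maps of \<open>R\<close> exist, so two powers of
  \<open>C\<close> agree on \<open>R\<close>. Cancelling the smaller power leaves one that fixes the
  simple roots, which span the space.\<close>

lemma C_finite_order: "\<exists>n>0. C ^^ n = id"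
proof -
  have "range (\<lambda>k::nat. restrict (C ^^ k) R) \<subseteq> R \<rightarrow>\<^sub>E R" using C_pow_root by auto
  then have "finite (range (\<lambda>k::nat. restrict (C ^^ k) R))"
    by (rule finite_subset) (simp add: finite_PiE finite_roots)
  then have "\<not> inj (\<lambda>k::nat. restrict (C ^^ k) R)" using finite_imageD infinite_UNIV_nat by blast
  then obtain k l :: nat where "k \<noteq> l" "restrict (C ^^ k) R = restrict (C ^^ l) R"
    by (auto simp: inj_def)
  then obtain k l :: nat where kl: "k < l" "restrict (C ^^ k) R = restrict (C ^^ l) R"
    by (metis linorder_neqE_nat)
  have "(C ^^ (l - k)) (a i) = id (a i)" if "i \<in> I" for i
  proof -
    have "(C ^^ k) ((C ^^ (l - k)) (a i)) = (C ^^ l) (a i)"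
      using kl(1) by (metis comp_apply funpow_add le_add_diff_inverse less_imp_le)
    also have "\<dots> = (C ^^ k) (a i)" using kl(2) a_root[OF that] by (metis restrict_apply')
    finally show ?thesis using inj_fn[OF inj_C, of k] by (simp add: inj_eq)
  qed
  then have "C ^^ (l - k) = id" by (intro a_linear_eq C_pow_linear linear_id)
  then show ?thesis using kl(1) by (intro exI[of _ "l - k"]) simp
qed

definition h :: nat where "h = coxeter_number C"

lemma h_pos: "h > 0" and C_pow_h: "C ^^ h = id"
  and h_le: "n > 0 \<Longrightarrow> C ^^ n = id \<Longrightarrow> h \<le> n"
  using C_finite_order LeastI_ex[of "\<lambda>n. n > 0 \<and> C ^^ n = id"]
    Least_le[of "\<lambda>n. n > 0 \<and> C ^^ n = id" n]
  by (auto simp: h_def coxeter_number_def)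

end

subsection \<open>Slices of the Auslander-Reiten quiver\<close>

locale coxeter_height = coxeter_base R P I a C
  for R P :: "'a::euclidean_space set" and I :: "'i set" and a :: "'i \<Rightarrow> 'a" and C +
  fixes \<eta> :: "'i \<Rightarrow> int"
  assumes arrow_height: "orientation I a C i j \<Longrightarrow> \<eta> j = \<eta> i + 1"
begin

text \<open>The vertex \<open>(i, n)\<close> of the Auslander-Reiten quiver carries the root \<open>\<gamma> i n\<close>; only
  indices with \<open>n\<close> congruent to \<open>\<eta> i\<close> modulo 2 are meaningful.\<close>

definition \<gamma> :: "'i \<Rightarrow> int \<Rightarrow> 'a" where
  "\<gamma> i n = (C ^^ nat (((n - \<eta> i) div 2) mod int h)) (\<beta> i)"

text \<open>As \<open>C ^^ h = id\<close>, reducing exponents modulo \<open>h\<close> lets natural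
  powers play the role of negative ones in \<open>\<gamma>\<close>.\<close>

lemma C_pow_mod: "(C ^^ (k mod h)) x = (C ^^ k) x"
  by (rule funpow_mod_eq) (simp add: C_pow_h)

lemma gamma_shift: "\<gamma> i (n + 2) = C (\<gamma> i n)"
proof -
  define k where "k = (n - \<eta> i) div 2"
  have 1: "(n + 2 - \<eta> i) div 2 = k + 1" by (simp add: k_def)
  have "(k + 1) mod int h = (k mod int h + 1) mod int h" by (simp add: mod_simps)
  moreover have "k mod int h \<ge> 0" using h_pos by simp
  ultimately have "nat ((k + 1) mod int h) = Suc (nat (k mod int h)) mod h"
    by (simp add: nat_mod_distrib nat_add_distrib)
  then show ?thesis unfolding \<gamma>_def 1 by (simp add: C_pow_mod k_def)
qed

lemma gamma_eta: "\<gamma> i (\<eta> i) = \<beta> i"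
  by (simp add: \<gamma>_def)

lemma gamma_period: "\<gamma> i (n + 2 * int h * k) = \<gamma> i n"
proof -
  have "(n + 2 * int h * k - \<eta> i) = (n - \<eta> i) + (int h * k) * 2" by simp
  then have "(n + 2 * int h * k - \<eta> i) div 2 = (n - \<eta> i) div 2 + int h * k" by simp
  then show ?thesis by (simp add: \<gamma>_def)
qed

lemma gamma_mod: "\<gamma> i (n mod (2 * int h)) = \<gamma> i n"
proof -
  have "n = n mod (2 * int h) + 2 * int h * (n div (2 * int h))" by simp
  then show ?thesis using gamma_period[of i "n mod (2 * int h)" "n div (2 * int h)"] by simp
qed

lemma height_neighbours: "j \<in> neighbours i \<Longrightarrow> \<bar>\<eta> i - \<eta> j\<bar> = 1"
  using arrow_height arrow_cases by fastforce

text \<open>This is the mesh relation at the height of \<open>i\<close>: targets of arrows from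
  \<open>i\<close> already lie one level higher, while sources of arrows into \<open>i\<close> are
  lifted there by \<open>C\<close>. It follows by computing \<open>C (a i)\<close> in two ways, from
  \<open>C_expansion\<close> and from \<open>beta_recursion\<close>.\<close>

lemma C_beta:
  assumes i: "i \<in> I"
  shows "\<beta> i + C (\<beta> i) = (\<Sum>j | arrow i j. \<beta> j) + (\<Sum>j | arrow j i. C (\<beta> j))"
proof -
  have "C (a i) = a i - (\<Sum>l\<in>I. (a i \<bullet> a l) *\<^sub>R \<beta> l)"
    using C_expansion beta_eq_cb by simp
  also have "(\<Sum>l\<in>I. (a i \<bullet> a l) *\<^sub>R \<beta> l)
      = (\<Sum>l\<in>I. (if l = i then 2 *\<^sub>R \<beta> l else 0) - (if l \<in> neighbours i then \<beta> l else 0))"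
    using i by (intro sum.cong) (auto simp: inner_a)
  also have "\<dots> = 2 *\<^sub>R \<beta> i - (\<Sum>l\<in>neighbours i. \<beta> l)"
    using i sum.inter_restrict[OF finite_I, of \<beta> "neighbours i"] neighbours_subset[of i]
    by (simp add: sum_subtractf Int_absorb1)
  also have "a i = \<beta> i - (\<Sum>j | arrow j i. \<beta> j)" using beta_recursion[OF i] by simp
  finally have "C (\<beta> i - (\<Sum>j | arrow j i. \<beta> j)) = - \<beta> i + (\<Sum>j | arrow i j. \<beta> j)"
    unfolding sum_neighbours_arrows by (simp add: scaleR_2)
  then have "C (\<beta> i) - (\<Sum>j | arrow j i. C (\<beta> j)) = - \<beta> i + (\<Sum>j | arrow i j. \<beta> j)"
    by (simp add: linear_diff[OF linear_C] linear_sum[OF linear_C])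
  then show ?thesis by (simp add: algebra_simps)
qed

text \<open>\<open>C_beta\<close> is the case \<open>n = \<eta> i\<close>. Applying
  \<open>C\<close>, or cancelling it by injectivity, moves the relation up or down by 2.\<close>

lemma gamma_mesh:
  assumes i: "i \<in> I" and n: "even (n - \<eta> i)"
  shows "\<gamma> i n + \<gamma> i (n + 2) = (\<Sum>j\<in>neighbours i. \<gamma> j (n + 1))"
proof -
  have "\<gamma> i (\<eta> i + 2 * k) + \<gamma> i (\<eta> i + 2 * k + 2) = (\<Sum>j\<in>neighbours i. \<gamma> j (\<eta> i + 2 * k + 1))" for k
  proof (induction k rule: int_induct[of _ 0])
    case base
    have "\<gamma> j (\<eta> i + 1) = \<beta> j" if "arrow i j" for j
      using arrow_height[OF that] gamma_eta[of j] by simp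
    moreover have "\<gamma> j (\<eta> i + 1) = C (\<beta> j)" if "arrow j i" for j
      using arrow_height[OF that] gamma_shift[of j "\<eta> j"] gamma_eta[of j] by (simp add: algebra_simps)
    ultimately show ?case
      using C_beta[OF i] by (simp add: sum_neighbours_arrows gamma_shift gamma_eta)
  next
    case (step1 k)
    have "\<gamma> j (\<eta> i + 2 * (k + 1)) = C (\<gamma> j (\<eta> i + 2 * k))"
      "\<gamma> j (\<eta> i + 2 * (k + 1) + 2) = C (\<gamma> j (\<eta> i + 2 * k + 2))"
      "\<gamma> j (\<eta> i + 2 * (k + 1) + 1) = C (\<gamma> j (\<eta> i + 2 * k + 1))" for j
      unfolding gamma_shift[symmetric] by (simp_all add: algebra_simps)
    then show ?case
      using arg_cong[OF step1(2), of C] by (simp only: linear_add[OF linear_C] linear_sum[OF linear_C])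
  next
    case (step2 k)
    have "\<gamma> j (\<eta> i + 2 * k) = C (\<gamma> j (\<eta> i + 2 * (k - 1)))"
      "\<gamma> j (\<eta> i + 2 * k + 2) = C (\<gamma> j (\<eta> i + 2 * (k - 1) + 2))"
      "\<gamma> j (\<eta> i + 2 * k + 1) = C (\<gamma> j (\<eta> i + 2 * (k - 1) + 1))" for j
      unfolding gamma_shift[symmetric] by (simp_all add: algebra_simps)
    then have "C (\<gamma> i (\<eta> i + 2 * (k - 1)) + \<gamma> i (\<eta> i + 2 * (k - 1) + 2)) =
        C (\<Sum>j\<in>neighbours i. \<gamma> j (\<eta> i + 2 * (k - 1) + 1))"
      using step2(2) by (simp only: linear_add[OF linear_C] linear_sum[OF linear_C])
    then show ?case using inj_C by (simp only: inj_eq)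
  qed
  moreover have "n = \<eta> i + 2 * ((n - \<eta> i) div 2)" using n by simp
  ultimately show ?thesis by metis
qed

text \<open>A slice is a lift \<open>t\<close> of the Dynkin diagram to the quiver. Raising it by 2 at a source
  composes the Weyl group element with the reflection in that source.\<close>

definition slice_root :: "('i \<Rightarrow> int) \<Rightarrow> 'i \<Rightarrow> 'a" where
  "slice_root t i = \<gamma> i (t i) - (\<Sum>j | j \<in> neighbours i \<and> t j < t i. \<gamma> j (t j))"

definition slice :: "('i \<Rightarrow> int) \<Rightarrow> bool" where
  "slice t \<longleftrightarrow> (\<forall>i\<in>I. even (t i - \<eta> i)) \<and> (\<forall>i\<in>I. \<forall>j\<in>neighbours i. \<bar>t i - t j\<bar> = 1) \<and>
     (\<exists>w\<in>weyl_group R. \<forall>i\<in>I. w (a i) = slice_root t i)"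

text \<open>For \<open>t = \<eta>\<close> the formula of \<open>slice_root\<close> is
  \<open>beta_recursion\<close> solved for the simple root, so the identity serves as Weyl group
  element.\<close>

lemma slice_eta: "slice \<eta>"
proof -
  have "\<eta> j < \<eta> i \<longleftrightarrow> arrow j i" if "j \<in> neighbours i" for i j
    using arrow_cases[OF that] arrow_height[of i j] arrow_height[of j i] by auto
  then have "{j. j \<in> neighbours i \<and> \<eta> j < \<eta> i} = {j. arrow j i}" for i
    using arrow_neighbours by blast
  then have "a i = slice_root \<eta> i" if "i \<in> I" for i
    using beta_recursion[OF that] by (simp add: slice_root_def gamma_eta)
  then show ?thesis using height_neighbours weyl_group.id[of R]
    by (auto simp: slice_def intro!: bexI[of _ id])
qed

text \<open>At a source \<open>w (a i) = \<gamma> i (t i)\<close>. Composing \<open>w\<close> with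
  the reflection in \<open>a i\<close> negates this root, which agrees with the new slice root by
  the mesh relation. A neighbour gains \<open>\<gamma> i (t i)\<close>, the term that leaves its sum
  because \<open>i\<close> now lies above it; all other slice roots stay.\<close>

lemma slice_step:
  assumes t: "slice t" and i: "i \<in> I" and source: "\<And>j. j \<in> neighbours i \<Longrightarrow> t j = t i + 1"
  shows "slice (t(i := t i + 2))"
proof -
  let ?t = "t(i := t i + 2)"
  obtain w where w: "w \<in> weyl_group R" "\<And>j. j \<in> I \<Longrightarrow> w (a j) = slice_root t j"
    using t by (auto simp: slice_def)
  have ev: "even (t i - \<eta> i)" using t i by (auto simp: slice_def)
  have lin: "linear w" using w(1) weyl_group_linear by blast
  define w' where "w' = w \<circ> root_reflection (a i)"
  have "(\<Sum>j | j \<in> neighbours i \<and> t j < t i. \<gamma> j (t j)) = 0"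
  proof (intro sum.neutral ballI)
    fix j assume "j \<in> {j. j \<in> neighbours i \<and> t j < t i}"
    then have "t j = t i + 1" "t j < t i" using source by blast+
    then show "\<gamma> j (t j) = 0" by linarith
  qed
  then have wi: "w (a i) = \<gamma> i (t i)" using w(2)[OF i] by (simp add: slice_root_def)
  have w': "w' (a j) = slice_root t j - (a j \<bullet> a i) *\<^sub>R \<gamma> i (t i)" if "j \<in> I" for j
    using norm_a[OF i] w(2)[OF that] wi
    by (simp add: w'_def root_reflection_eq linear_diff[OF lin] linear_cmul[OF lin])
  have "w' (a j) = slice_root ?t j" if j: "j \<in> I" for j
  proof -
    consider "j = i" | "j \<in> neighbours i" | "j \<noteq> i" "j \<notin> neighbours i" by blast
    then show ?thesis
    proof cases
      case 1
      have tk: "?t k = t i + 1" if "k \<in> neighbours i" for k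
        using source[OF that] that by (cases "k = i") simp_all
      have "?t k < ?t i" if "k \<in> neighbours i" for k using tk[OF that] by simp
      then have "{j. j \<in> neighbours i \<and> ?t j < ?t i} = neighbours i" by blast
      then have "slice_root ?t i = \<gamma> i (t i + 2) - (\<Sum>j\<in>neighbours i. \<gamma> j (?t j))"
        by (simp add: slice_root_def)
      also have "(\<Sum>j\<in>neighbours i. \<gamma> j (?t j)) = (\<Sum>j\<in>neighbours i. \<gamma> j (t i + 1))"
        by (rule sum.cong[OF refl]) (use tk in simp)
      also have "\<dots> = \<gamma> i (t i) + \<gamma> i (t i + 2)" using gamma_mesh[OF i ev] by simp
      finally have "slice_root ?t i = - \<gamma> i (t i)" by (simp del: fun_upd_apply)
      moreover have "w' (a i) = \<gamma> i (t i) - 2 *\<^sub>R \<gamma> i (t i)"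
        using w'[OF i] w(2)[OF i] wi norm_a[OF i] by simp
      ultimately show ?thesis using 1 by (simp add: scaleR_2)
    next
      case 2
      then have tj: "t j = t i + 1" and ji: "j \<noteq> i" "i \<in> neighbours j"
        using source neighbours_sym by auto
      let ?L = "{k. k \<in> neighbours j \<and> ?t k < ?t j}"
      have L: "{k. k \<in> neighbours j \<and> t k < t j} = insert i ?L" "i \<notin> ?L"
        using tj ji by auto
      have "?L \<subseteq> neighbours j" by blast
      then have "finite ?L" by (rule finite_subset) simp
      then have "slice_root t j = \<gamma> j (t j) - (\<gamma> i (t i) + (\<Sum>k\<in>?L. \<gamma> k (t k)))"
        unfolding slice_root_def L(1) using L(2) by simp
      also have "(\<Sum>k\<in>?L. \<gamma> k (t k)) = (\<Sum>k\<in>?L. \<gamma> k (?t k))"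
        using L(2) by (intro sum.cong) auto
      finally have "slice_root t j = slice_root ?t j - \<gamma> i (t i)"
        using ji by (simp add: slice_root_def)
      moreover have "a j \<bullet> a i = -1" using inner_a[OF j i] ji by simp
      ultimately show ?thesis using w'[OF j] by simp
    next
      case 3
      then have "i \<notin> neighbours j" using neighbours_sym by blast
      then have "{k. k \<in> neighbours j \<and> ?t k < ?t j} = {k. k \<in> neighbours j \<and> t k < t j}"
        using 3 by auto
      moreover have "(\<Sum>k | k \<in> neighbours j \<and> t k < t j. \<gamma> k (?t k)) = (\<Sum>k | k \<in> neighbours j \<and> t k < t j. \<gamma> k (t k))"
        using \<open>i \<notin> neighbours j\<close> by (intro sum.cong) auto
      ultimately have "slice_root ?t j = slice_root t j" using 3 by (simp add: slice_root_def)
      moreover have "a j \<bullet> a i = 0" using inner_a[OF j i] 3 \<open>i \<notin> neighbours j\<close> by simp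
      ultimately show ?thesis using w'[OF j] by simp
    qed
  qed
  moreover have "w' \<in> weyl_group R"
    unfolding w'_def using w(1) a_root[OF i] by (intro weyl_group_comp weyl_group_reflection)
  moreover have "\<bar>?t j - ?t k\<bar> = 1" if "j \<in> I" "k \<in> neighbours j" for j k
  proof -
    have "\<bar>t j - t k\<bar> = 1" using t that by (auto simp: slice_def)
    moreover have "k = i \<Longrightarrow> t j = t i + 1" "j = i \<Longrightarrow> t k = t i + 1"
      using that source neighbours_sym by blast+
    ultimately show ?thesis using that by auto
  qed
  moreover have "\<forall>j\<in>I. even (?t j - \<eta> j)" using t ev by (auto simp: slice_def)
  ultimately show ?thesis unfolding slice_def by blast
qed

text \<open>The zigzag slice occupying only the levels \<open>n\<close> and \<open>n + 1\<close>.
  Its slice roots reduce to single roots up to sign, see \<open>bipartite_base\<close>.\<close>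

definition bip :: "int \<Rightarrow> 'i \<Rightarrow> int" where
  "bip n i = (if even (n - \<eta> i) then n else n + 1)"

text \<open>A lowest vertex still below its target is a source and can be raised by
  \<open>slice_step\<close>. Current height and target have equal parity, so a step of 2 does not
  overshoot, and the total distance to the target decreases.\<close>

lemma slice_reach_bip:
  assumes "slice t" "\<And>i. i \<in> I \<Longrightarrow> t i \<le> bip n i"
  shows "\<exists>w\<in>weyl_group R. \<forall>i\<in>I. w (a i) = slice_root (bip n) i"
  using assms
proof (induction "nat (\<Sum>i\<in>I. bip n i - t i)" arbitrary: t rule: less_induct)
  case less
  show ?case
  proof (cases "\<forall>i\<in>I. t i = bip n i")
    case True
    have "slice_root t i = slice_root (bip n) i" if "i \<in> I" for i
    proof -
      have "{j. j \<in> neighbours i \<and> t j < t i} = {j. j \<in> neighbours i \<and> bip n j < bip n i}"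
        using True that neighbours_in_I by auto
      moreover have "(\<Sum>j | j \<in> neighbours i \<and> bip n j < bip n i. \<gamma> j (t j)) =
          (\<Sum>j | j \<in> neighbours i \<and> bip n j < bip n i. \<gamma> j (bip n j))"
        using True neighbours_in_I by (intro sum.cong) auto
      ultimately show ?thesis using True that by (simp add: slice_root_def)
    qed
    then show ?thesis using less.prems(1) by (auto simp: slice_def)
  next
    case False
    define T where "T = {i\<in>I. t i < bip n i}"
    have "finite T" "T \<noteq> {}" using False less.prems(2) by (auto simp: T_def order_less_le)
    then obtain i where i: "i \<in> T" "\<And>j. j \<in> T \<Longrightarrow> t i \<le> t j"
      by (meson arg_min_if_finite(1) arg_min_least)
    have iI: "i \<in> I" "t i < bip n i" using i by (auto simp: T_def)
    have ht: "even (t j - \<eta> j)" if "j \<in> I" for j using less.prems(1) that by (auto simp: slice_def)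
    have evb: "even (bip n j - \<eta> j)" for j by (auto simp: bip_def)
    have source: "t j = t i + 1" if j: "j \<in> neighbours i" for j
    proof (rule ccontr)
      assume "t j \<noteq> t i + 1"
      moreover have "\<bar>t i - t j\<bar> = 1" using less.prems(1) iI j by (auto simp: slice_def)
      ultimately have tj: "t j = t i - 1" by auto
      then have "j \<notin> T" using i(2)[of j] by auto
      then have "t j \<ge> bip n j" using neighbours_in_I[OF j] by (auto simp: T_def)
      \<comment> \<open>Here \<open>t i < bip n i\<close> gives \<open>t i \<le> n\<close>, hence
        \<open>t j \<le> n - 1\<close>, whereas \<open>bip n j \<ge> n\<close>.\<close>
      then show False using tj iI(2) by (auto simp: bip_def split: if_splits)
    qed
    let ?t = "t(i := t i + 2)"
    have "t i + 2 \<le> bip n i"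
    proof -
      have "even (bip n i - t i)" using ht[OF iI(1)] evb[of i] by presburger
      then show ?thesis using iI(2) by presburger
    qed
    then have le: "?t j \<le> bip n j" if "j \<in> I" for j using less.prems(2) that by auto
    have "(\<Sum>j\<in>I. bip n j - ?t j) < (\<Sum>j\<in>I. bip n j - t j)"
      using iI(1) by (intro sum_strict_mono_ex1) auto
    moreover have "(\<Sum>j\<in>I. bip n j - ?t j) \<ge> 0" using le by (intro sum_nonneg) auto
    ultimately have "nat (\<Sum>j\<in>I. bip n j - ?t j) < nat (\<Sum>j\<in>I. bip n j - t j)" by linarith
    then show ?thesis
      using less.hyps slice_step[OF less.prems(1) iI(1) source] le by blast
  qed
qed

text \<open>Slices are only raised, so a level \<open>m\<close> above \<open>\<eta>\<close> and
  congruent to \<open>n\<close> modulo \<open>2 * h\<close> is reached, and periodicity brings the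
  result back to \<open>n\<close>. A vertex at level \<open>m\<close> has no neighbours below; at
  level \<open>m + 1\<close> the mesh relation turns the slice root into
  \<open>- \<gamma> i (m - 1)\<close>.\<close>

lemma bipartite_base:
  "\<exists>w\<in>weyl_group R. \<forall>i\<in>I. w (a i) = (if even (n - \<eta> i) then \<gamma> i n else - \<gamma> i (n - 1))"
proof -
  define N where "N = nat (\<Sum>i\<in>I. \<bar>\<eta> i - n\<bar>)"
  \<comment> \<open>Since \<open>2 * h \<ge> 1\<close>, the multiple \<open>N\<close> of the period
    is large enough to exceed every height.\<close>
  define m where "m = n + 2 * int h * int N"
  have "\<eta> i \<le> bip m i" if "i \<in> I" for i
  proof -
    have "\<bar>\<eta> i - n\<bar> \<le> (\<Sum>i\<in>I. \<bar>\<eta> i - n\<bar>)" using that by (intro member_le_sum) auto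
    then have "\<eta> i \<le> n + int N" by (simp add: N_def)
    moreover have "1 * int N \<le> (2 * int h) * int N" using h_pos by (intro mult_right_mono) auto
    ultimately have "\<eta> i \<le> m" by (simp add: m_def)
    then show ?thesis by (auto simp: bip_def)
  qed
  then obtain w where w: "w \<in> weyl_group R" "\<And>i. i \<in> I \<Longrightarrow> w (a i) = slice_root (bip m) i"
    using slice_reach_bip[OF slice_eta] by blast
  have par: "even (m - \<eta> i) \<longleftrightarrow> even (n - \<eta> i)" for i by (simp add: m_def)
  have nbpar: "even (m - \<eta> j) \<longleftrightarrow> odd (m - \<eta> i)" if "j \<in> neighbours i" for i j
    using height_neighbours[OF that] by presburger
  have per: "\<gamma> i m = \<gamma> i n" "\<gamma> i (m - 1) = \<gamma> i (n - 1)" for i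
    using gamma_period[of i n "int N"] gamma_period[of i "n - 1" "int N"] by (simp_all add: m_def algebra_simps)
  have "w (a i) = (if even (n - \<eta> i) then \<gamma> i n else - \<gamma> i (n - 1))" if i: "i \<in> I" for i
  proof (cases "even (m - \<eta> i)")
    case True
    then have "{j. j \<in> neighbours i \<and> bip m j < bip m i} = {}" using nbpar by (auto simp: bip_def)
    then have "w (a i) = \<gamma> i (bip m i)" unfolding w(2)[OF i] slice_root_def by (simp only: sum.empty diff_zero)
    also have "bip m i = m" using True by (simp add: bip_def)
    finally have "w (a i) = \<gamma> i n" unfolding per .
    moreover have "even (n - \<eta> i)" using True unfolding par .
    ultimately show ?thesis by (simp only: if_True)
  next
    case False
    then have "{j. j \<in> neighbours i \<and> bip m j < bip m i} = neighbours i" using nbpar by (auto simp: bip_def)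
    then have "w (a i) = \<gamma> i (bip m i) - (\<Sum>j\<in>neighbours i. \<gamma> j (bip m j))"
      unfolding w(2)[OF i] slice_root_def by (simp only:)
    also have "bip m i = m + 1" using False by (simp add: bip_def)
    also have "(\<Sum>j\<in>neighbours i. \<gamma> j (bip m j)) = (\<Sum>j\<in>neighbours i. \<gamma> j m)"
      using nbpar False by (intro sum.cong) (auto simp: bip_def)
    also have "\<dots> = \<gamma> i (m - 1) + \<gamma> i (m + 1)"
      using gamma_mesh[OF i, of "m - 1"] False by (simp add: algebra_simps)
    finally have "w (a i) = - \<gamma> i (n - 1)" unfolding per[symmetric] by simp
    moreover have "odd (n - \<eta> i)" using False unfolding par .
    ultimately show ?thesis by (simp only: if_False)
  qed
  then show ?thesis using w(1) by blast
qed

lemma gamma_root: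
  assumes "i \<in> I" "even (n - \<eta> i)"
  shows "\<gamma> i n \<in> R"
  using bipartite_base[of n] assms a_root weyl_group_root[OF root_sys] by force

end

subsection \<open>Phases in the Coxeter plane\<close>

text \<open>The weights \<open>v\<close> and the eigenvalue \<open>2 * cos \<theta>\<close> are
  those of \<open>perron_vector\<close>. The assumption \<open>stabilizer\<close> is the consequence
  of equivariant labelling needed here: a Weyl group element preserving a simple system fixes it
  pointwise.\<close>

locale coxeter_phase = coxeter_height R P I a C \<eta>
  for R P :: "'a::euclidean_space set" and I :: "'i set" and a :: "'i \<Rightarrow> 'a" and C \<eta> +
  fixes v :: "'i \<Rightarrow> real" and \<theta> :: real
  assumes I_ne: "I \<noteq> {}"
    and v_pos: "i \<in> I \<Longrightarrow> v i > 0"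
    and theta: "0 < \<theta>" "\<theta> \<le> pi / 2"
    and perron: "i \<in> I \<Longrightarrow> (\<Sum>j\<in>neighbours i. v j) = 2 * cos \<theta> * v i"
    and stabilizer: "simple_root_system R Q \<Longrightarrow> w \<in> weyl_group R \<Longrightarrow> w ` Q = Q \<Longrightarrow> x \<in> Q \<Longrightarrow> w x = x"
begin

lemma sin_theta: "sin \<theta> > 0"
  using theta pi_gt_zero by (intro sin_gt_zero) linarith+

lemma v_nonneg: "i \<in> I \<Longrightarrow> 0 \<le> v i"
  using v_pos less_imp_le by blast

text \<open>\<open>Z\<close> is the projection to the Coxeter plane, on which \<open>C\<close> acts by rotation.\<close>

definition Z :: "'a \<Rightarrow> complex" where
  "Z = (SOME f. linear f \<and> (\<forall>i\<in>I. f (a i) = of_real (v i) * cis (\<theta> * of_int (\<eta> i)) -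
      (\<Sum>j | arrow j i. of_real (v j) * cis (\<theta> * of_int (\<eta> j)))))"

lemma linear_Z: "linear Z"
  and Z_a: "i \<in> I \<Longrightarrow> Z (a i) = of_real (v i) * cis (\<theta> * of_int (\<eta> i)) -
      (\<Sum>j | arrow j i. of_real (v j) * cis (\<theta> * of_int (\<eta> j)))"
  using someI_ex[OF a_linear_extend[of "\<lambda>i. of_real (v i) * cis (\<theta> * of_int (\<eta> i)) -
      (\<Sum>j | arrow j i. of_real (v j) * cis (\<theta> * of_int (\<eta> j)))"]]
  unfolding Z_def[symmetric] by blast+

text \<open>The values prescribed for \<open>Z\<close> on the simple roots are
  \<open>beta_recursion\<close> solved for \<open>a i\<close>, with the desired values inserted for
  the roots \<open>\<beta> j\<close>; induction along arrows recovers the latter.\<close>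

lemma Z_beta: "i \<in> I \<Longrightarrow> Z (\<beta> i) = of_real (v i) * cis (\<theta> * of_int (\<eta> i))"
proof -
  obtain f :: "'i \<Rightarrow> nat" where f: "\<And>i j. arrow i j \<longleftrightarrow> j \<in> neighbours i \<and> f i < f j" "inj_on f I"
    using arrow_index by blast
  show "i \<in> I \<Longrightarrow> Z (\<beta> i) = of_real (v i) * cis (\<theta> * of_int (\<eta> i))"
  proof (induction "f i" arbitrary: i rule: less_induct)
    case less
    have "(\<Sum>j | arrow j i. Z (\<beta> j)) = (\<Sum>j | arrow j i. of_real (v j) * cis (\<theta> * of_int (\<eta> j)))"
      using less.hyps f(1) arrow_in_I by (intro sum.cong) auto
    then show ?case
      unfolding beta_recursion[OF less.prems] linear_add[OF linear_Z] linear_sum[OF linear_Z] Z_a[OF less.prems]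
      by simp
  qed
qed

lemma cis_add_cis: "cis x + cis (x + 2 * \<theta>) = of_real (2 * cos \<theta>) * cis (x + \<theta>)"
proof -
  have "cis x = cis (x + \<theta>) * cis (- \<theta>)" "cis (x + 2 * \<theta>) = cis (x + \<theta>) * cis \<theta>"
    by (simp_all add: cis_mult algebra_simps)
  moreover have "cis (- \<theta>) + cis \<theta> = of_real (2 * cos \<theta>)" by (simp add: complex_eq_iff)
  ultimately show ?thesis by (metis distrib_left mult.commute)
qed

text \<open>\<open>C (a i)\<close> is the sum of \<open>\<beta> j\<close> over the arrows from
  \<open>i\<close> to \<open>j\<close>, minus \<open>\<beta> i\<close>. The eigenvalue equation for
  \<open>v\<close> and \<open>cis_add_cis\<close> then turn the claim on simple roots into the
  planar form of the mesh relation.\<close>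

lemma Z_C: "Z (C x) = cis (2 * \<theta>) * Z x"
proof -
  have "Z (C (a i)) = cis (2 * \<theta>) * Z (a i)" if i: "i \<in> I" for i
  proof -
    let ?e = "\<lambda>n::int. cis (\<theta> * of_int n)"
    have "C (a i) = C (\<beta> i) - (\<Sum>j | arrow j i. C (\<beta> j))"
      using beta_recursion[OF i] by (simp add: linear_add[OF linear_C] linear_sum[OF linear_C])
    also have "\<dots> = (\<Sum>j | arrow i j. \<beta> j) - \<beta> i" using C_beta[OF i] by (simp add: algebra_simps)
    finally have "Z (C (a i)) = (\<Sum>j | arrow i j. Z (\<beta> j)) - Z (\<beta> i)"
      by (simp add: linear_diff[OF linear_Z] linear_sum[OF linear_Z])
    also have "(\<Sum>j | arrow i j. Z (\<beta> j)) = (\<Sum>j | arrow i j. of_real (v j) * ?e (\<eta> i + 1))"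
      using arrow_in_I arrow_height by (intro sum.cong) (auto simp: Z_beta)
    finally have lhs: "Z (C (a i)) = (\<Sum>j | arrow i j. of_real (v j) * ?e (\<eta> i + 1)) - of_real (v i) * ?e (\<eta> i)"
      using Z_beta[OF i] by simp
    have "cis (2 * \<theta>) * ?e (\<eta> j) = ?e (\<eta> i + 1)" if "arrow j i" for j
      using arrow_height[OF that] by (simp add: cis_mult algebra_simps)
    then have "cis (2 * \<theta>) * (of_real (v j) * ?e (\<eta> j)) = of_real (v j) * ?e (\<eta> i + 1)" if "arrow j i" for j
      using that by (metis mult.left_commute)
    then have 1: "cis (2 * \<theta>) * (\<Sum>j | arrow j i. of_real (v j) * ?e (\<eta> j)) = (\<Sum>j | arrow j i. of_real (v j) * ?e (\<eta> i + 1))"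
      unfolding sum_distrib_left by (intro sum.cong) auto
    have 2: "cis (2 * \<theta>) * (of_real (v i) * ?e (\<eta> i)) = of_real (v i) * cis (\<theta> * of_int (\<eta> i) + 2 * \<theta>)"
      by (simp add: cis_mult mult.left_commute add.commute)
    have rhs: "cis (2 * \<theta>) * Z (a i) = of_real (v i) * cis (\<theta> * of_int (\<eta> i) + 2 * \<theta>)
        - (\<Sum>j | arrow j i. of_real (v j) * ?e (\<eta> i + 1))"
      unfolding Z_a[OF i] right_diff_distrib 1 2 ..
    have "(\<Sum>j | arrow i j. of_real (v j) * ?e (\<eta> i + 1)) + (\<Sum>j | arrow j i. of_real (v j) * ?e (\<eta> i + 1))
        = of_real (\<Sum>j\<in>neighbours i. v j) * ?e (\<eta> i + 1)"
      by (simp add: sum_neighbours_arrows distrib_right flip: sum_distrib_right)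
    also have "\<dots> = of_real (v i) * (of_real (2 * cos \<theta>) * cis (\<theta> * of_int (\<eta> i) + \<theta>))"
      using perron[OF i] by (simp add: algebra_simps)
    also have "\<dots> = of_real (v i) * (?e (\<eta> i) + cis (\<theta> * of_int (\<eta> i) + 2 * \<theta>))"
      using cis_add_cis[of "\<theta> * of_int (\<eta> i)"] by simp
    finally show ?thesis unfolding lhs rhs by (simp add: algebra_simps)
  qed
  moreover have "linear (Z \<circ> C)" using linear_C linear_Z by (rule linear_compose)
  moreover have "linear (\<lambda>x. cis (2 * \<theta>) * Z x)"
    by (rule linearI) (simp_all add: linear_add[OF linear_Z] linear_cmul[OF linear_Z] algebra_simps)
  ultimately have "Z \<circ> C = (\<lambda>x. cis (2 * \<theta>) * Z x)" by (intro a_linear_eq) simp_all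
  then show ?thesis by (metis comp_apply)
qed

lemma Z_gamma:
  assumes i: "i \<in> I" and n: "even (n - \<eta> i)"
  shows "Z (\<gamma> i n) = of_real (v i) * cis (\<theta> * of_int n)"
proof -
  have "Z (\<gamma> i (\<eta> i + 2 * k)) = of_real (v i) * cis (\<theta> * of_int (\<eta> i + 2 * k))" for k
  proof (induction k rule: int_induct[of _ 0])
    case base
    then show ?case using Z_beta[OF i] by (simp add: gamma_eta)
  next
    case (step1 k)
    have "Z (\<gamma> i (\<eta> i + 2 * k + 2)) = of_real (v i) * (cis (2 * \<theta>) * cis (\<theta> * of_int (\<eta> i + 2 * k)))"
      using step1 by (simp only: gamma_shift Z_C mult.left_commute)
    then show ?case by (simp add: cis_mult algebra_simps)
  next
    case (step2 k)
    have "cis (2 * \<theta>) * Z (\<gamma> i (\<eta> i + 2 * (k - 1))) = Z (\<gamma> i (\<eta> i + 2 * k))"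
      unfolding Z_C[symmetric] gamma_shift[symmetric] by (simp add: algebra_simps)
    also have "\<dots> = cis (2 * \<theta>) * (of_real (v i) * cis (\<theta> * of_int (\<eta> i + 2 * (k - 1))))"
      using step2 by (simp add: cis_mult algebra_simps)
    finally show ?case by simp
  qed
  moreover have "\<eta> i + 2 * ((n - \<eta> i) div 2) = n" using n by simp
  ultimately show ?thesis by metis
qed

text \<open>The sign of \<open>phase n x\<close> is that of the sine of the argument of \<open>Z x\<close> minus \<open>\<theta> n\<close>.\<close>

definition phase :: "int \<Rightarrow> 'a \<Rightarrow> real" where
  "phase n x = Im (cis (- \<theta> * of_int n) * Z x)"

lemma linear_phase: "linear (phase n)"
  by (rule linearI)
    (simp_all add: phase_def linear_add[OF linear_Z] linear_cmul[OF linear_Z] algebra_simps)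

lemma phase_gamma:
  assumes "i \<in> I" "even (m - \<eta> i)"
  shows "phase n (\<gamma> i m) = v i * sin (\<theta> * of_int (m - n))"
proof -
  have eq: "cis (- \<theta> * of_int n) * (of_real (v i) * cis (\<theta> * of_int m)) = of_real (v i) * cis (\<theta> * of_int (m - n))"
    by (simp add: cis_mult mult.left_commute) (simp add: algebra_simps)
  show ?thesis unfolding phase_def Z_gamma[OF assms] eq by simp
qed

lemma phase_C_pow: "phase n ((C ^^ k) x) = phase (n - 2 * int k) x"
proof (induction k arbitrary: n)
  case (Suc k)
  have "cis (- \<theta> * of_int n) * cis (2 * \<theta>) = cis (- \<theta> * of_int (n - 2))"
    by (simp add: cis_mult algebra_simps)
  then have "phase n (C y) = phase (n - 2) y" for y unfolding phase_def Z_C by (metis mult.assoc)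
  then show ?case using Suc.IH[of "n - 2"] by (simp add: algebra_simps)
qed simp

text \<open>The numbers \<open>\<omega> i \<bullet> y\<close> are the coordinates of
  \<open>x\<close> in the simple system of level \<open>n\<close>. On that system
  \<open>phase n\<close> vanishes at each \<open>\<gamma> i n\<close> and equals
  \<open>sin \<theta> * v i\<close> at each \<open>- \<gamma> i (n - 1)\<close>; for
  \<open>phase (n - 1)\<close> the two kinds exchange roles.\<close>

lemma phase_slice:
  assumes x: "x \<in> R"
  shows "\<exists>w y. w \<in> weyl_group R \<and> y \<in> R \<and> x = w y \<and>
    (\<forall>i\<in>I. w (a i) = (if even (n - \<eta> i) then \<gamma> i n else - \<gamma> i (n - 1))) \<and>
    phase n x = sin \<theta> * (\<Sum>i | i \<in> I \<and> odd (n - \<eta> i). (\<omega> i \<bullet> y) * v i) \<and>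
    phase (n - 1) x = sin \<theta> * (\<Sum>i | i \<in> I \<and> even (n - \<eta> i). (\<omega> i \<bullet> y) * v i)"
proof -
  obtain w where w: "w \<in> weyl_group R"
    and wa: "\<And>i. i \<in> I \<Longrightarrow> w (a i) = (if even (n - \<eta> i) then \<gamma> i n else - \<gamma> i (n - 1))"
    using bipartite_base by blast
  obtain y where y: "y \<in> R" "x = w y" using weyl_group_image_roots[OF root_sys w] x by blast
  have lin: "linear (phase m \<circ> w)" for m
    using weyl_group_linear[OF w] linear_phase by (rule linear_compose)
  have expand: "phase m x = (\<Sum>i\<in>I. (\<omega> i \<bullet> y) * phase m (w (a i)))" for m
  proof -
    have "phase m x = (phase m \<circ> w) (\<Sum>i\<in>I. (\<omega> i \<bullet> y) *\<^sub>R a i)" using y(2) omega_expansion[of y] by simp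
    also have "\<dots> = (\<Sum>i\<in>I. (\<omega> i \<bullet> y) * phase m (w (a i)))"
      unfolding linear_sum[OF lin] linear_cmul[OF lin] by simp
    finally show ?thesis .
  qed
  have neg: "phase m (- z) = - phase m z" for m z by (rule linear_neg[OF linear_phase])
  have 1: "phase n (w (a i)) = (if odd (n - \<eta> i) then sin \<theta> * v i else 0)" if "i \<in> I" for i
    unfolding wa[OF that] using phase_gamma[OF that, of n n] phase_gamma[OF that, of "n - 1" n] by (auto simp: neg)
  have 2: "phase (n - 1) (w (a i)) = (if even (n - \<eta> i) then sin \<theta> * v i else 0)" if "i \<in> I" for i
    unfolding wa[OF that] using phase_gamma[OF that, of n "n - 1"] phase_gamma[OF that, of "n - 1" "n - 1"]
    by (auto simp: neg)
  have "phase n x = (\<Sum>i\<in>I. if odd (n - \<eta> i) then sin \<theta> * ((\<omega> i \<bullet> y) * v i) else 0)"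
    unfolding expand by (intro sum.cong) (auto simp: 1)
  also have "\<dots> = sin \<theta> * (\<Sum>i | i \<in> I \<and> odd (n - \<eta> i). (\<omega> i \<bullet> y) * v i)"
    unfolding sum_distrib_left by (rule sum.inter_filter[symmetric]) simp
  finally have A: "phase n x = sin \<theta> * (\<Sum>i | i \<in> I \<and> odd (n - \<eta> i). (\<omega> i \<bullet> y) * v i)" .
  have "phase (n - 1) x = (\<Sum>i\<in>I. if even (n - \<eta> i) then sin \<theta> * ((\<omega> i \<bullet> y) * v i) else 0)"
    unfolding expand by (intro sum.cong) (auto simp: 2)
  also have "\<dots> = sin \<theta> * (\<Sum>i | i \<in> I \<and> even (n - \<eta> i). (\<omega> i \<bullet> y) * v i)"
    unfolding sum_distrib_left by (rule sum.inter_filter[symmetric]) simp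
  finally have B: "phase (n - 1) x = sin \<theta> * (\<Sum>i | i \<in> I \<and> even (n - \<eta> i). (\<omega> i \<bullet> y) * v i)" .
  show ?thesis using w y wa A B by blast
qed

text \<open>Both phases are combinations, with nonnegative weights, of coordinates of a root, which
  all have one sign. Geometrically, no root points strictly between the directions
  \<open>\<theta> * (n - 1)\<close> and \<open>\<theta> * n\<close> modulo \<pi>.\<close>

lemma phase_adjacent:
  assumes x: "x \<in> R"
  shows "0 \<le> phase n x * phase (n - 1) x"
proof -
  obtain w y where *: "w \<in> weyl_group R" "y \<in> R" "x = w y"
    "\<forall>i\<in>I. w (a i) = (if even (n - \<eta> i) then \<gamma> i n else - \<gamma> i (n - 1))"
    "phase n x = sin \<theta> * (\<Sum>i | i \<in> I \<and> odd (n - \<eta> i). (\<omega> i \<bullet> y) * v i)"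
    "phase (n - 1) x = sin \<theta> * (\<Sum>i | i \<in> I \<and> even (n - \<eta> i). (\<omega> i \<bullet> y) * v i)"
    using phase_slice[OF x, of n] by (elim exE conjE)
  consider "\<forall>i\<in>I. \<omega> i \<bullet> y \<ge> 0" | "\<forall>i\<in>I. \<omega> i \<bullet> y \<le> 0" using omega_root_signs[OF *(2)] by blast
  then show ?thesis
  proof cases
    case 1
    then have "phase n x \<ge> 0" "phase (n - 1) x \<ge> 0" unfolding *(5,6) using less_imp_le[OF sin_theta] v_nonneg
      by (auto intro!: mult_nonneg_nonneg sum_nonneg)
    then show ?thesis by simp
  next
    case 2
    then have "(\<omega> i \<bullet> y) * v i \<le> 0" if "i \<in> I" for i
      using v_nonneg that by (intro mult_nonpos_nonneg) auto
    then have "(\<Sum>i | i \<in> I \<and> Q i. (\<omega> i \<bullet> y) * v i) \<le> 0" for Q by (intro sum_nonpos) auto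
    note nonpos = mult_nonneg_nonpos[OF less_imp_le[OF sin_theta] this]
    have "phase n x \<le> 0" "phase (n - 1) x \<le> 0" unfolding *(5,6) by (rule nonpos)+
    then show ?thesis by (rule mult_nonpos_nonpos)
  qed
qed

text \<open>The coordinates share one sign and \<open>v\<close> is positive, so those at odd
  vertices vanish. The neighbours of an even vertex are odd, hence a nonzero coordinate
  \<open>c\<close> at \<open>i\<close> gives \<open>a i \<bullet> y = 2 * c\<close>; comparing
  squared lengths yields \<open>c = 1\<close> or \<open>c = -1\<close> and
  \<open>y = c *\<^sub>R a i\<close>.\<close>

lemma phase_zero:
  assumes x: "x \<in> R" and zero: "phase n x = 0"
  shows "\<exists>i\<in>I. even (n - \<eta> i) \<and> (x = \<gamma> i n \<or> x = - \<gamma> i n)"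
proof -
  obtain w y where *: "w \<in> weyl_group R" "y \<in> R" "x = w y"
    "\<forall>i\<in>I. w (a i) = (if even (n - \<eta> i) then \<gamma> i n else - \<gamma> i (n - 1))"
    "phase n x = sin \<theta> * (\<Sum>i | i \<in> I \<and> odd (n - \<eta> i). (\<omega> i \<bullet> y) * v i)"
    "phase (n - 1) x = sin \<theta> * (\<Sum>i | i \<in> I \<and> even (n - \<eta> i). (\<omega> i \<bullet> y) * v i)"
    using phase_slice[OF x, of n] by (elim exE conjE)
  have sum0: "(\<Sum>i | i \<in> I \<and> odd (n - \<eta> i). (\<omega> i \<bullet> y) * v i) = 0"
    using zero *(5) sin_theta by simp
  have odd0: "\<omega> i \<bullet> y = 0" if i: "i \<in> I" "odd (n - \<eta> i)" for i
  proof -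
    consider "\<forall>i\<in>I. \<omega> i \<bullet> y \<ge> 0" | "\<forall>i\<in>I. \<omega> i \<bullet> y \<le> 0" using omega_root_signs[OF *(2)] by blast
    then have "(\<omega> i \<bullet> y) * v i = 0"
    proof cases
      case 1
      then have "\<forall>i\<in>{i. i \<in> I \<and> odd (n - \<eta> i)}. (\<omega> i \<bullet> y) * v i = 0"
        using sum0 v_nonneg by (subst (asm) sum_nonneg_eq_0_iff) (auto intro!: mult_nonneg_nonneg)
      then show ?thesis using i by blast
    next
      case 2
      then have "\<forall>i\<in>{i. i \<in> I \<and> odd (n - \<eta> i)}. - ((\<omega> i \<bullet> y) * v i) = 0"
        using sum0 v_nonneg by (subst sum_nonneg_eq_0_iff[symmetric])
          (auto simp: sum_negf intro!: mult_nonpos_nonneg)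
      then show ?thesis using i by simp
    qed
    then show ?thesis using v_pos[OF i(1)] by simp
  qed
  have "y \<noteq> 0" using *(2) root_sys by (auto simp: root_system_def)
  then obtain i where i: "i \<in> I" "\<omega> i \<bullet> y \<noteq> 0"
    using omega_expansion[of y] by (metis (no_types, lifting) scaleR_zero_left sum.neutral)
  define c where "c = \<omega> i \<bullet> y"
  have ev: "even (n - \<eta> i)" using odd0 i by blast
  obtain k :: int where k: "c = of_int k" using omega_root_signs[OF *(2)] i(1) c_def by metis
  have "\<omega> j \<bullet> y = 0" if j: "j \<in> neighbours i" for j
  proof -
    have "odd (n - \<eta> j)" using height_neighbours[OF j] ev by presburger
    then show ?thesis using odd0 neighbours_in_I[OF j] by blast
  qed
  then have "a i \<bullet> (\<Sum>j\<in>I. (\<omega> j \<bullet> y) *\<^sub>R a j) = 2 * c"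
    using inner_a_sum[OF i(1) subset_refl, of "\<lambda>j. \<omega> j \<bullet> y"] i(1) by (simp add: c_def)
  then have ay: "a i \<bullet> y = 2 * c" using omega_expansion[of y] by simp
  have eq: "(y - c *\<^sub>R a i) \<bullet> (y - c *\<^sub>R a i) = 2 - 2 * c\<^sup>2"
    using ay norm_a[OF i(1)] norm_root[OF *(2)]
    by (simp add: inner_diff_left inner_diff_right inner_commute power2_eq_square)
  then have "0 \<le> 2 - 2 * c\<^sup>2" by (metis inner_ge_zero)
  then have "\<bar>c\<bar> \<le> 1" by (simp add: abs_square_le_1)
  then have c: "c = 1 \<or> c = -1" using k i(2) c_def by (simp add: abs_if split: if_splits)
  then have "y - c *\<^sub>R a i = 0" using eq by (metis (no_types) cancel_comm_monoid_add_class.diff_cancel inner_eq_zero_iff mult.right_neutral one_power2 power2_minus)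
  then have "y = c *\<^sub>R a i" by (simp only: right_minus_eq)
  then have "x = c *\<^sub>R w (a i)"
    using *(3) linear_cmul[OF weyl_group_linear[OF *(1)], of c "a i"] by simp
  then show ?thesis using *(4)[rule_format, OF i(1)] ev c i(1) by (intro bexI[of _ i]) auto
qed

text \<open>The sign of the preceding phase separates \<open>\<gamma> i n\<close> from its negative.
  The roots of level \<open>n\<close> are thereby characterised by phases alone.\<close>

lemma phase_crossing:
  "{x\<in>R. phase n x = 0 \<and> phase (n - 1) x > 0} = {\<gamma> i n |i. i \<in> I \<and> even (n - \<eta> i)}"
proof (intro equalityI subsetI)
  fix x assume "x \<in> {x\<in>R. phase n x = 0 \<and> phase (n - 1) x > 0}"
  then have x: "x \<in> R" "phase n x = 0" "phase (n - 1) x > 0" by auto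
  obtain i where i: "i \<in> I" "even (n - \<eta> i)" "x = \<gamma> i n \<or> x = - \<gamma> i n" using phase_zero[OF x(1,2)] by blast
  have "phase (n - 1) (\<gamma> i n) = v i * sin \<theta>" using phase_gamma[OF i(1,2), of "n - 1"] by simp
  then have "phase (n - 1) (- \<gamma> i n) < 0"
    using v_pos[OF i(1)] sin_theta by (simp add: linear_neg[OF linear_phase])
  then have "x = \<gamma> i n" using i(3) x(3) by auto
  then show "x \<in> {\<gamma> i n |i. i \<in> I \<and> even (n - \<eta> i)}" using i by blast
next
  fix x assume "x \<in> {\<gamma> i n |i. i \<in> I \<and> even (n - \<eta> i)}"
  then obtain i where i: "i \<in> I" "even (n - \<eta> i)" "x = \<gamma> i n" by blast
  then show "x \<in> {x\<in>R. phase n x = 0 \<and> phase (n - 1) x > 0}"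
    using phase_gamma[OF i(1,2), of n] phase_gamma[OF i(1,2), of "n - 1"] gamma_root[OF i(1,2)] v_pos[OF i(1)] sin_theta
    by simp
qed

text \<open>Take for \<open>m\<close> the ceiling of \<open>pi / \<theta>\<close>. If
  \<open>\<theta> * m\<close> exceeded \<pi>, the root \<open>\<beta> i\<close> would have phases of
  opposite strict signs at the adjacent levels \<open>\<eta> i - (m - 1)\<close> and
  \<open>\<eta> i - m\<close>, against \<open>phase_adjacent\<close>.\<close>

lemma theta_divides_pi: obtains m :: nat where "m > 0" "\<theta> * real m = pi"
proof -
  obtain i where i: "i \<in> I" using I_ne by blast
  define m where "m = nat \<lceil>pi / \<theta>\<rceil>"
  have "pi / \<theta> \<ge> 2" using theta by (simp add: field_simps)
  then have m: "real m \<ge> pi / \<theta>" "real m - 1 < pi / \<theta>" "real m \<ge> 2" unfolding m_def by linarith+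
  have b: "(real m - 1) * \<theta> < pi" "pi \<le> \<theta> * real m" "(real m - 1) * \<theta> > 0"
    using m theta by (simp_all add: field_simps)
  have "0 \<le> phase (\<eta> i - int (m - 1)) (\<gamma> i (\<eta> i)) * phase (\<eta> i - int (m - 1) - 1) (\<gamma> i (\<eta> i))"
    using phase_adjacent gamma_root[OF i] by simp
  moreover have "phase (\<eta> i - int (m - 1)) (\<gamma> i (\<eta> i)) = v i * sin ((real m - 1) * \<theta>)"
    using phase_gamma[OF i, of "\<eta> i"] m(3) by (simp add: of_nat_diff mult.commute)
  moreover have "phase (\<eta> i - int (m - 1) - 1) (\<gamma> i (\<eta> i)) = v i * sin (\<theta> * real m)"
    using phase_gamma[OF i, of "\<eta> i"] m(3) by (simp add: of_nat_diff)
  moreover have "sin ((real m - 1) * \<theta>) > 0" using b by (intro sin_gt_zero)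
  ultimately have "0 \<le> sin (\<theta> * real m)"
    using v_pos[OF i] by (simp add: zero_le_mult_iff mult_le_0_iff)
  moreover have "sin (\<theta> * real m) < 0" if "\<theta> * real m > pi"
  proof -
    have "\<theta> * real m < 2 * pi" using b(1) theta by (simp add: algebra_simps)
    then show ?thesis using that by (intro sin_lt_zero)
  qed
  ultimately have "\<theta> * real m = pi" using b(2) by force
  then show ?thesis using that[of m] m(3) by simp
qed

text \<open>If \<open>m \<theta> = \<pi>\<close> then \<open>C ^^ m\<close> fixes all phases, so it permutes the simple roots of a bipartite
  slice, which are characterised by their phases.\<close>

lemma C_pow_id:
  assumes m: "\<theta> * real m = pi"
  shows "C ^^ m = id"
proof -
  have "cis (- \<theta> * of_int (n - 2 * int m)) = cis (- \<theta> * of_int n)" for n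
  proof -
    have "- \<theta> * of_int (n - 2 * int m) = - \<theta> * of_int n + 2 * pi"
      using m by (simp add: algebra_simps)
    then have "cis (- \<theta> * of_int (n - 2 * int m)) = cis (- \<theta> * of_int n) * cis (2 * pi)"
      by (simp only: cis_mult)
    then show ?thesis by simp
  qed
  then have phase_inv: "phase n ((C ^^ m) x) = phase n x" for n x
    unfolding phase_C_pow unfolding phase_def by simp
  obtain w where w: "w \<in> weyl_group R"
    "\<And>i. i \<in> I \<Longrightarrow> w (a i) = (if even (0 - \<eta> i) then \<gamma> i 0 else - \<gamma> i (0 - 1))"
    using bipartite_base[of 0] by blast
  define S where "S n = {x\<in>R. phase n x = 0 \<and> phase (n - 1) x > 0}" for n
  have wP: "w ` P = S 0 \<union> uminus ` S (-1)"
  proof (intro equalityI subsetI)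
    fix x assume "x \<in> w ` P"
    then obtain i where i: "i \<in> I" "x = w (a i)" using base_image by blast
    show "x \<in> S 0 \<union> uminus ` S (-1)"
    proof (cases "even (0 - \<eta> i)")
      case True
      then have "x = \<gamma> i 0" using i w(2) by simp
      then show ?thesis unfolding S_def phase_crossing using i True by blast
    next
      case False
      then have "x = - \<gamma> i (-1)" using i w(2) by simp
      moreover have "even (-1 - \<eta> i)" using False by simp
      ultimately show ?thesis unfolding S_def phase_crossing using i by blast
    qed
  next
    fix x assume "x \<in> S 0 \<union> uminus ` S (-1)"
    then consider i where "i \<in> I" "even (0 - \<eta> i)" "x = \<gamma> i 0" | i where "i \<in> I" "even (-1 - \<eta> i)" "x = - \<gamma> i (-1)"
      unfolding S_def phase_crossing by blast
    then have "\<exists>i\<in>I. x = w (a i)"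
    proof cases
      case 1
      then show ?thesis using w(2) by (intro bexI[of _ i]) simp_all
    next
      case 2
      then show ?thesis using w(2) by (intro bexI[of _ i]) simp_all
    qed
    then show "x \<in> w ` P" using base_image by blast
  qed
  have "(C ^^ m) ` S n \<subseteq> S n" for n
    using phase_inv C_pow_root by (auto simp: S_def)
  then have "(C ^^ m) ` (w ` P) \<subseteq> w ` P"
    unfolding wP by (force simp: linear_neg[OF C_pow_linear])
  moreover have "finite (w ` P)" using base_image finite_I by (metis finite_imageI)
  moreover have "inj_on (C ^^ m) (w ` P)" using inj_fn[OF inj_C] by (auto simp: inj_on_def inj_def)
  ultimately have img: "(C ^^ m) ` (w ` P) = w ` P" by (simp add: endo_inj_surj)
  have Cw: "C ^^ m \<in> weyl_group R" using weyl_group_funpow[OF C_weyl] .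
  \<comment> \<open>A permutation of the simple system could still be a nontrivial diagram
    automorphism; \<open>stabilizer\<close> rules this out.\<close>
  have "(C ^^ m) x = x" if "x \<in> w ` P" for x
    using stabilizer[OF simple_root_system_weyl[OF root_sys base w(1)] Cw img that] .
  then have "((C ^^ m) \<circ> w) (a i) = w (a i)" if "i \<in> I" for i using that base_image by auto
  then have "(C ^^ m) \<circ> w = w"
    using weyl_group_linear[OF w(1)] C_pow_linear by (intro a_linear_eq linear_compose) auto
  moreover have "surj w" using weyl_group_bij[OF w(1)] by (simp add: bij_def)
  ultimately show ?thesis by (metis comp_apply eq_id_iff surj_def)
qed

text \<open>The bound from above is \<open>C_pow_id\<close> together with minimality of
  \<open>h\<close>. Conversely \<open>C ^^ h = id\<close> makes the rotation by
  \<open>2 * \<theta> * h\<close> trivial, so \<open>\<theta> * h\<close> is a positive multiple of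
  \<pi>.\<close>

lemma theta_h: "\<theta> * real h = pi"
proof -
  obtain m :: nat where m: "m > 0" "\<theta> * real m = pi" using theta_divides_pi .
  have "h \<le> m" using h_le[OF m(1) C_pow_id[OF m(2)]] .
  then have le: "\<theta> * real h \<le> pi" using m(2) theta(1) by (metis mult_left_mono of_nat_mono less_imp_le)
  have pos: "\<theta> * real h > 0" using theta(1) h_pos by simp
  obtain i where i: "i \<in> I" using I_ne by blast
  have per: "phase (n - 2 * int h) x = phase n x" for n x using phase_C_pow[of n h x] C_pow_h by simp
  have s0: "sin (2 * (\<theta> * real h)) = 0"
    using per[of "\<eta> i" "\<gamma> i (\<eta> i)"] phase_gamma[OF i, of "\<eta> i"] v_pos[OF i] by (simp add: mult.left_commute)
  have s1: "sin (\<theta> + 2 * (\<theta> * real h)) = sin \<theta>"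
    using per[of "\<eta> i - 1" "\<gamma> i (\<eta> i)"] phase_gamma[OF i, of "\<eta> i"] v_pos[OF i] by (simp add: algebra_simps)
  then have "cos (2 * (\<theta> * real h)) = 1" using s0 sin_theta by (simp add: sin_add)
  then obtain q :: int where "2 * (\<theta> * real h) = of_int q * 2 * pi" using cos_one_2pi_int by blast
  then have q: "\<theta> * real h = of_int q * pi" by simp
  then have "q > 0" using pos by (simp add: zero_less_mult_iff)
  then have "1 * pi \<le> of_int q * pi" by (intro mult_right_mono) auto
  then show ?thesis using le q by simp
qed

text \<open>Phases at the levels \<open>n\<close> and \<open>n - 1\<close> show that
  \<open>\<theta> * (m - n)\<close> has sine 0 and positive cosine, so \<open>m - n\<close> is a
  multiple of \<open>2 * h\<close>, hence 0. Two roots of the same level are images of simple roots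
  under one injective \<open>w\<close>.\<close>

lemma gamma_inj:
  assumes i: "i \<in> I" "even (n - \<eta> i)" and j: "j \<in> I" "even (m - \<eta> j)"
    and eq: "\<gamma> i n = \<gamma> j m" and near: "\<bar>m - n\<bar> < 2 * int h"
  shows "i = j \<and> n = m"
proof -
  have "v j * sin (\<theta> * of_int (m - n)) = 0"
    using phase_gamma[OF i, of n] phase_gamma[OF j, of n] eq by simp
  then have s0: "sin (\<theta> * of_int (m - n)) = 0" using v_pos[OF j(1)] by simp
  have "v j * sin (\<theta> * of_int (m - n) + \<theta>) = v i * sin \<theta>"
    using phase_gamma[OF i, of "n - 1"] phase_gamma[OF j, of "n - 1"] eq by (simp add: algebra_simps)
  then have "v j * (cos (\<theta> * of_int (m - n)) * sin \<theta>) > 0"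
    using s0 mult_pos_pos[OF v_pos[OF i(1)] sin_theta] by (simp only: sin_add mult_zero_left add_0)
  then have "cos (\<theta> * of_int (m - n)) > 0"
    using v_pos[OF j(1)] sin_theta by (simp add: zero_less_mult_iff)
  then have "cos (\<theta> * of_int (m - n)) = 1"
    using s0 sin_cos_squared_add[of "\<theta> * of_int (m - n)"] by (simp add: power2_eq_1_iff)
  then obtain q :: int where "\<theta> * of_int (m - n) = of_int q * 2 * pi" using cos_one_2pi_int by blast
  then have "\<theta> * of_int (m - n) = \<theta> * of_int (2 * int h * q)" using theta_h by (simp add: algebra_simps)
  then have "real_of_int (m - n) = of_int (2 * int h * q)" using theta(1) by (metis mult_cancel_left less_irrefl)
  then have d: "m - n = 2 * int h * q" by (simp only: of_int_eq_iff)
  have "q = 0"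
  proof (rule ccontr)
    assume "q \<noteq> 0"
    then have "\<bar>q\<bar> \<ge> 1" by simp
    then have "2 * int h * \<bar>q\<bar> \<ge> 2 * int h * 1" by (intro mult_left_mono) auto
    then show False using near d by (simp add: abs_mult)
  qed
  then have nm: "n = m" using d by simp
  obtain w where w: "w \<in> weyl_group R"
    "\<And>i. i \<in> I \<Longrightarrow> w (a i) = (if even (n - \<eta> i) then \<gamma> i n else - \<gamma> i (n - 1))"
    using bipartite_base[of n] by blast
  have "w (a i) = w (a j)" using w(2) i j nm eq by simp
  then have "a i = a j" using weyl_group_bij[OF w(1)] by (simp add: bij_def inj_eq)
  then show ?thesis using inj_a i(1) j(1) nm by (auto simp: inj_on_def)
qed

text \<open>Raising the level by \<open>h\<close> negates the phase. Starting where it is positive,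
  there is a first level with phase at most 0; by \<open>phase_adjacent\<close> the phase is 0
  there, and \<open>phase_crossing\<close> identifies the root.\<close>

lemma gamma_surj:
  assumes x: "x \<in> R"
  shows "\<exists>i n. i \<in> I \<and> even (n - \<eta> i) \<and> x = \<gamma> i n"
proof -
  have neg: "phase (n + int h) x = - phase n x" for n
  proof -
    have "- \<theta> * of_int (n + int h) = - \<theta> * of_int n + - pi" using theta_h by (simp add: algebra_simps)
    then have "cis (- \<theta> * of_int (n + int h)) = cis (- \<theta> * of_int n) * cis (- pi)" by (simp only: cis_mult)
    then show ?thesis by (simp add: phase_def)
  qed
  have "\<exists>n. phase n x \<noteq> 0"
  proof (rule ccontr)
    assume "\<not> ?thesis"
    then have z: "phase n x = 0" for n by blast
    obtain i where i: "i \<in> I" "even (0 - \<eta> i)" "x = \<gamma> i 0 \<or> x = - \<gamma> i 0" using phase_zero[OF x z] by blast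
    have "phase (-1) (\<gamma> i 0) = v i * sin \<theta>" using phase_gamma[OF i(1,2), of "-1"] by simp
    then show False using z[of "-1"] i v_pos[OF i(1)] sin_theta by (auto simp: linear_neg[OF linear_phase])
  qed
  then obtain n0 where n0: "phase n0 x > 0" using neg by (metis linorder_neqE_linordered_idom neg_0_less_iff_less)
  define k where "k = (LEAST k::nat. phase (n0 + int k) x \<le> 0)"
  have ex: "phase (n0 + int h) x \<le> 0" using neg n0 by simp
  have k: "phase (n0 + int k) x \<le> 0" unfolding k_def using ex by (rule LeastI)
  then have "k \<noteq> 0" using n0 by (cases "k = 0") auto
  then have "\<not> phase (n0 + int (k - 1)) x \<le> 0" using not_less_Least[of "k - 1" "\<lambda>k. phase (n0 + int k) x \<le> 0"]
    by (simp add: k_def)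
  then have pos: "phase (n0 + int k - 1) x > 0" using \<open>k \<noteq> 0\<close> by (simp add: of_nat_diff algebra_simps)
  then have "phase (n0 + int k) x \<ge> 0" using phase_adjacent[OF x, of "n0 + int k"] by (simp add: zero_le_mult_iff)
  then have "phase (n0 + int k) x = 0" using k by simp
  then have "x \<in> {\<gamma> i (n0 + int k) |i. i \<in> I \<and> even (n0 + int k - \<eta> i)}"
    unfolding phase_crossing[symmetric] using x pos by simp
  then show ?thesis by blast
qed

end

section \<open>The bijection modulo \<open>2 * h\<close> and its uniqueness\<close>

lemma bit_of_int_eq_0_iff: "(of_int n :: bit) = 0 \<longleftrightarrow> even n"
proof (cases "even n")
  case True
  then show ?thesis by (auto elim!: evenE)
next
  case False
  then show ?thesis by (auto elim!: oddE)
qed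

lemma bit_add_of_int_eq_0_iff: "(b::bit) + of_int n = 0 \<longleftrightarrow> (b = 0 \<longleftrightarrow> even n)"
proof -
  have "(of_int n :: bit) = of_bool (odd n)"
    using bit_of_int_eq_0_iff[of n] by (cases "of_int n :: bit") auto
  then show ?thesis by (cases b) auto
qed

text \<open>Two representatives of residues differ by less than \<open>2 * h\<close>, as
  \<open>gamma_inj\<close> requires. Reduction modulo the even number \<open>2 * h\<close> preserves
  parity, so the roots found by \<open>gamma_surj\<close> are already reached by vertices.\<close>

lemma (in coxeter_phase) hat_bijection:
  assumes parity: "\<And>i. i \<in> I \<Longrightarrow> p i + of_int (\<eta> i) = 0"
  shows "bij_betw (\<lambda>(i, n). \<gamma> i n) (hat_vertices I p h) R"
proof -
  have hat: "(i, n) \<in> hat_vertices I p h \<longleftrightarrow> i \<in> I \<and> 0 \<le> n \<and> n < 2 * int h \<and> even (n - \<eta> i)" for i n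
    using parity unfolding hat_vertices_def bit_add_of_int_eq_0_iff by auto
  have "inj_on (\<lambda>(i, n). \<gamma> i n) (hat_vertices I p h)"
  proof (rule inj_onI, clarify)
    fix i n j m
    assume "(i, n) \<in> hat_vertices I p h" "(j, m) \<in> hat_vertices I p h" "\<gamma> i n = \<gamma> j m"
    then show "i = j \<and> n = m" using gamma_inj[of i n j m] hat by auto
  qed
  moreover have "(\<lambda>(i, n). \<gamma> i n) ` hat_vertices I p h = R"
  proof (intro equalityI subsetI)
    fix x assume "x \<in> (\<lambda>(i, n). \<gamma> i n) ` hat_vertices I p h"
    then show "x \<in> R" using gamma_root hat by auto
  next
    fix x assume "x \<in> R"
    then obtain i n where x: "i \<in> I" "even (n - \<eta> i)" "x = \<gamma> i n" using gamma_surj by blast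
    let ?n = "n mod (2 * int h)"
    have "even ?n \<longleftrightarrow> even n" by (simp add: dvd_mod_iff)
    then have "even (?n - \<eta> i)" using x(2) by simp
    moreover have "0 \<le> ?n" "?n < 2 * int h" using h_pos by simp_all
    ultimately have "(i, ?n) \<in> hat_vertices I p h" using hat x(1) by blast
    moreover have "x = \<gamma> i ?n" using x(3) gamma_mod by simp
    ultimately show "x \<in> (\<lambda>(i, n). \<gamma> i n) ` hat_vertices I p h" by (auto intro: rev_image_eqI)
  qed
  ultimately show ?thesis by (simp add: bij_betw_def)
qed

theorem theorem5p4:
  fixes R P :: "'a::euclidean_space set"
    and I :: "'i set"
    and \<alpha> :: "'a set \<Rightarrow> 'i \<Rightarrow> 'a"
    and C :: "'a \<Rightarrow> 'a"
    and h :: nat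
    and p :: "'i \<Rightarrow> bit"
    and i\<^sub>0 :: 'i
    and \<Phi>\<^sub>0 :: "'a \<Rightarrow> 'i \<times> int"
  assumes "reduced_root_system R" and "irreducible_root_system R" and "simply_laced R"
    and "equivariant_labelling R I \<alpha>"
    and "coxeter_element R C"
    and "h = coxeter_number C"
    and "simple_root_system R P"
    and "compatible I (\<alpha> P) C"
    and "\<And>i j. dynkin_edge I (\<alpha> P) i j \<Longrightarrow> p i = p j + 1"
    and "i\<^sub>0 \<in> I"
    and "bij_betw \<Phi>\<^sub>0 (orbit_of C (beta_root I (\<alpha> P) C i\<^sub>0)) {x \<in> hat_vertices I p h. fst x = i\<^sub>0}"
    and "\<And>\<beta>. \<beta> \<in> orbit_of C (beta_root I (\<alpha> P) C i\<^sub>0) \<Longrightarrow> \<Phi>\<^sub>0 (C \<beta>) = hat_shift h (\<Phi>\<^sub>0 \<beta>)"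
  shows "\<exists>!\<Phi>. \<Phi> \<in> R \<rightarrow>\<^sub>E hat_vertices I p h \<and>
           bij_betw \<Phi> R (hat_vertices I p h) \<and>
           (\<forall>\<beta>\<in>R. \<Phi> (C \<beta>) = hat_shift h (\<Phi> \<beta>)) \<and>
           (\<exists>\<eta> \<in> I \<rightarrow> {0..<2 * int h}. \<forall>i\<in>I. \<Phi> (beta_root I (\<alpha> P) C i) = (i, \<eta> i)) \<and>
           (\<forall>i j n. orientation I (\<alpha> P) C i j \<and> \<Phi> (beta_root I (\<alpha> P) C i) = (i, n) \<longrightarrow>
              \<Phi> (beta_root I (\<alpha> P) C j) = (j, (n + 1) mod (2 * int h))) \<and>
           (\<forall>\<beta>\<in>orbit_of C (beta_root I (\<alpha> P) C i\<^sub>0). \<Phi> \<beta> = \<Phi>\<^sub>0 \<beta>)"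
proof -
  let ?\<beta> = "beta_root I (\<alpha> P) C" and ?hat = "hat_vertices I p h"
  interpret A: coxeter_base R P I "\<alpha> P" C
    using assms(1-4,7,8)
    by unfold_locales (auto simp: reduced_root_system_def equivariant_labelling_def)
  have hA: "A.h = h" using assms(6) by (simp add: A.h_def)
  have orbit: "(C ^^ k) (?\<beta> i\<^sub>0) \<in> orbit_of C (?\<beta> i\<^sub>0)" for k by (auto simp: orbit_of_def)
  have "\<Phi>\<^sub>0 (?\<beta> i\<^sub>0) \<in> {x \<in> ?hat. fst x = i\<^sub>0}"
    using bij_betw_apply[OF assms(11)] orbit[of 0] by simp
  then obtain n\<^sub>0 where n0: "\<Phi>\<^sub>0 (?\<beta> i\<^sub>0) = (i\<^sub>0, n\<^sub>0)" "0 \<le> n\<^sub>0" "n\<^sub>0 < 2 * int h" "p i\<^sub>0 + of_int n\<^sub>0 = 0"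
    by (cases "\<Phi>\<^sub>0 (?\<beta> i\<^sub>0)") (auto simp: hat_vertices_def)
  obtain \<eta>' :: "'i \<Rightarrow> int" where \<eta>': "\<forall>i j. orientation I (\<alpha> P) C i j \<longrightarrow> \<eta>' j = \<eta>' i + 1"
    using A.height_exists by blast
  \<comment> \<open>A height function may be shifted by a constant; this shift matches the value of
    \<open>\<Phi>\<^sub>0\<close> at the root of \<open>i\<^sub>0\<close>.\<close>
  define \<eta> where "\<eta> i = \<eta>' i - \<eta>' i\<^sub>0 + n\<^sub>0" for i
  have I_ne: "I \<noteq> {}" using assms(10) by blast
  obtain v and t :: real where v: "\<forall>i\<in>I. v i > 0" and t: "0 \<le> t" "t < 2"
    and vt: "\<forall>i\<in>I. (\<Sum>j\<in>A.neighbours i. v j) = t * v i"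
    using A.perron_vector[OF I_ne] by (elim exE conjE)
  \<comment> \<open>The bounds \<open>0 \<le> t < 2\<close> place \<theta> in the half-open interval
    from 0, excluded, to \<open>pi / 2\<close>.\<close>
  define \<theta> where "\<theta> = arccos (t / 2)"
  have cos_theta: "2 * cos \<theta> = t" using t by (simp add: \<theta>_def)
  interpret B: coxeter_phase R P I "\<alpha> P" C \<eta> v \<theta>
  proof
    show "orientation I (\<alpha> P) C i j \<Longrightarrow> \<eta> j = \<eta> i + 1" for i j using \<eta>' by (simp add: \<eta>_def)
    show "I \<noteq> {}" by (rule I_ne)
    show "i \<in> I \<Longrightarrow> 0 < v i" for i using v by blast
    show "0 < \<theta>" using t arccos_lt_bounded[of "t / 2"] by (simp add: \<theta>_def)
    show "\<theta> \<le> pi / 2" using t arccos_le_pi2[of "t / 2"] by (simp add: \<theta>_def)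
    show "i \<in> I \<Longrightarrow> (\<Sum>j\<in>A.neighbours i. v j) = 2 * cos \<theta> * v i" for i
      unfolding cos_theta using vt by blast
    fix Q w x
    assume Q: "simple_root_system R Q" and w: "w \<in> weyl_group R" "w ` Q = Q" and x: "x \<in> Q"
    have bij: "bij_betw (\<alpha> Q) I Q" using assms(4) Q by (simp add: equivariant_labelling_def)
    have eqv: "w (\<alpha> Q i) = \<alpha> (w ` Q) i" if "i \<in> I" for i
      using assms(4) Q w(1) that unfolding equivariant_labelling_def by blast
    obtain i where "i \<in> I" "x = \<alpha> Q i" using x bij by (auto simp: bij_betw_def)
    then show "w x = x" using eqv w(2) by simp
  qed
  have eta0: "\<eta> i\<^sub>0 = n\<^sub>0" by (simp add: \<eta>_def)
  \<comment> \<open>Both sides flip along every edge, so the agreement at \<open>i\<^sub>0\<close>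
    spreads over the connected diagram.\<close>
  have parity: "p i = 0 \<longleftrightarrow> even (\<eta> i)" if "i \<in> I" for i
    using A.dynkin_connected[OF assms(10) that]
  proof (induction rule: rtranclp_induct)
    case base
    then show ?case using n0(4) eta0 unfolding bit_add_of_int_eq_0_iff by simp
  next
    case (step j k)
    have "\<bar>\<eta> j - \<eta> k\<bar> = 1" using step.hyps(2) by (intro B.height_neighbours) (simp add: A.neighbours_def)
    then have "even (\<eta> k) \<longleftrightarrow> odd (\<eta> j)" by presburger
    then show ?case using step.IH assms(9)[OF step.hyps(2)] by (cases "p k") auto
  qed
  define G where "G = (\<lambda>(i, n). B.\<gamma> i n)"
  have bijG: "bij_betw G ?hat R" unfolding G_def using B.hat_bijection[of p] parity hA
    unfolding bit_add_of_int_eq_0_iff by simp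
  \<comment> \<open>The restriction makes the map extensional, so uniqueness can be literal equality
    of functions.\<close>
  define \<Phi> where "\<Phi> = restrict (inv_into ?hat G) R"
  have \<Phi>_\<gamma>: "\<Phi> (B.\<gamma> i n) = (i, n mod (2 * int h))" if i: "i \<in> I" "even (n - \<eta> i)" for i n
  proof -
    let ?n = "n mod (2 * int h)"
    have "even ?n \<longleftrightarrow> even n" by (simp add: dvd_mod_iff)
    then have "even (?n - \<eta> i)" using i(2) by simp
    then have "(i, ?n) \<in> ?hat"
      using i(1) parity[OF i(1)] A.h_pos hA unfolding hat_vertices_def bit_add_of_int_eq_0_iff by auto
    moreover have "G (i, ?n) = B.\<gamma> i n" using B.gamma_mod[of i n] hA by (simp add: G_def)
    ultimately have "inv_into ?hat G (B.\<gamma> i n) = (i, ?n)"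
      using bijG by (metis bij_betw_inv_into_left)
    then show ?thesis using B.gamma_root[OF i] by (simp add: \<Phi>_def)
  qed
  have \<beta>_root: "?\<beta> i \<in> R" if "i \<in> I" for i
    using B.gamma_root[OF that, of "\<eta> i"] by (simp add: B.gamma_eta)
  have \<Phi>_\<beta>: "\<Phi> (?\<beta> i) = (i, \<eta> i mod (2 * int h))" if "i \<in> I" for i
    using \<Phi>_\<gamma>[OF that, of "\<eta> i"] by (simp add: B.gamma_eta)
  have \<Phi>_C: "\<Phi> (C x) = hat_shift h (\<Phi> x)" if xR: "x \<in> R" for x
  proof -
    obtain i n where x: "i \<in> I" "even (n - \<eta> i)" "x = B.\<gamma> i n" using B.gamma_surj[OF xR] by blast
    have "\<Phi> (C x) = (i, (n + 2) mod (2 * int h))"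
      using \<Phi>_\<gamma>[OF x(1), of "n + 2"] x B.gamma_shift by simp
    then show ?thesis using \<Phi>_\<gamma>[OF x(1,2)] x(3) by (simp add: hat_shift_def mod_simps)
  qed
  have \<Phi>_PiE: "\<Phi> \<in> R \<rightarrow>\<^sub>E ?hat"
    using bijG by (auto simp: \<Phi>_def bij_betw_def intro!: inv_into_into)
  have \<Phi>_bij: "bij_betw \<Phi> R ?hat"
    using bij_betw_inv_into[OF bijG] by (rule bij_betw_cong[THEN iffD1, rotated]) (simp add: \<Phi>_def)
  have \<Phi>_edge: "\<Phi> (?\<beta> j) = (j, (n + 1) mod (2 * int h))"
    if "orientation I (\<alpha> P) C i j" "\<Phi> (?\<beta> i) = (i, n)" for i j n
    using \<Phi>_\<beta>[of i] \<Phi>_\<beta>[of j] A.arrow_in_I[OF that(1)] B.arrow_height[OF that(1)] that(2)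
    by (auto simp: mod_simps)
  have \<Phi>_orbit: "\<Phi> x = \<Phi>\<^sub>0 x" if "x \<in> orbit_of C (?\<beta> i\<^sub>0)" for x
  proof -
    have "\<Phi> ((C ^^ k) (?\<beta> i\<^sub>0)) = \<Phi>\<^sub>0 ((C ^^ k) (?\<beta> i\<^sub>0))" for k
    proof (induction k)
      case 0
      then show ?case using \<Phi>_\<beta>[OF assms(10)] n0 eta0 by simp
    next
      case (Suc k)
      then show ?case
        using \<Phi>_C[OF A.C_pow_root[OF \<beta>_root[OF assms(10)], of k]] assms(12)[OF orbit[of k]] by simp
    qed
    then show ?thesis using that by (auto simp: orbit_of_def)
  qed
  \<comment> \<open>The prescribed value at \<open>i\<^sub>0\<close> and the edge condition, read in
    both directions, determine the heights of all roots \<open>?\<beta> i\<close>. Equivariance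
    under \<open>C\<close> extends the equality to their orbits, which cover
    \<open>R\<close>.\<close>
  have unique: "\<Psi> = \<Phi>" if \<Psi>: "\<Psi> \<in> R \<rightarrow>\<^sub>E ?hat" "\<forall>x\<in>R. \<Psi> (C x) = hat_shift h (\<Psi> x)"
    "\<exists>\<eta> \<in> I \<rightarrow> {0..<2 * int h}. \<forall>i\<in>I. \<Psi> (?\<beta> i) = (i, \<eta> i)"
    "\<forall>i j n. orientation I (\<alpha> P) C i j \<and> \<Psi> (?\<beta> i) = (i, n) \<longrightarrow>
        \<Psi> (?\<beta> j) = (j, (n + 1) mod (2 * int h))"
    "\<forall>x\<in>orbit_of C (?\<beta> i\<^sub>0). \<Psi> x = \<Phi>\<^sub>0 x" for \<Psi>
  proof -
    obtain \<zeta> where "\<zeta> \<in> I \<rightarrow> {0..<2 * int h}" "\<forall>i\<in>I. \<Psi> (?\<beta> i) = (i, \<zeta> i)"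
      using \<Psi>(3) by blast
    then have \<zeta>: "\<And>i. i \<in> I \<Longrightarrow> 0 \<le> \<zeta> i \<and> \<zeta> i < 2 * int h" "\<And>i. i \<in> I \<Longrightarrow> \<Psi> (?\<beta> i) = (i, \<zeta> i)"
      by (auto simp: Pi_iff)
    have "\<zeta> i = \<eta> i mod (2 * int h) \<and> i \<in> I" if "i \<in> I" for i
      using A.dynkin_connected[OF assms(10) that]
    proof (induction rule: rtranclp_induct)
      case base
      have "\<Psi> (?\<beta> i\<^sub>0) = \<Phi>\<^sub>0 (?\<beta> i\<^sub>0)" using \<Psi>(5) orbit[of 0] by simp
      then show ?case using \<zeta>(2)[OF assms(10)] n0 eta0 assms(10) by simp
    next
      case (step j k)
      then have k: "k \<in> A.neighbours j" by (simp add: A.neighbours_def)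
      have jk: "j \<in> I" "k \<in> I" using A.neighbours_in_I[OF k] .
      consider "orientation I (\<alpha> P) C j k" | "orientation I (\<alpha> P) C k j"
        using A.arrow_cases[OF k] by blast
      then show ?case
      proof cases
        case 1
        then have "\<zeta> k = (\<zeta> j + 1) mod (2 * int h)" using \<Psi>(4) \<zeta>(2)[OF jk(1)] \<zeta>(2)[OF jk(2)] by auto
        then show ?thesis using step.IH B.arrow_height[OF 1] jk(2) by (simp add: mod_simps)
      next
        case 2
        then have "\<zeta> j = (\<zeta> k + 1) mod (2 * int h)" using \<Psi>(4) \<zeta>(2)[OF jk(1)] \<zeta>(2)[OF jk(2)] by auto
        then have "(\<zeta> k + 1) mod (2 * int h) = (\<eta> k + 1) mod (2 * int h)"
          using step.IH B.arrow_height[OF 2] by simp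
        \<comment> \<open>The arrow points towards the known vertex, so 1 is cancelled modulo
          \<open>2 * h\<close>; the range of \<open>\<zeta> k\<close> then removes the
          reduction.\<close>
        then have "(\<zeta> k + 1 - 1) mod (2 * int h) = (\<eta> k + 1 - 1) mod (2 * int h)"
          by (rule mod_diff_cong) simp
        then show ?thesis using \<zeta>(1)[OF jk(2)] jk(2) by simp
      qed
    qed
    then have eq_\<beta>: "\<Psi> (?\<beta> i) = \<Phi> (?\<beta> i)" if "i \<in> I" for i
      using that \<zeta>(2) \<Phi>_\<beta> by simp
    have eq_orbit: "\<Psi> ((C ^^ k) (?\<beta> i)) = \<Phi> ((C ^^ k) (?\<beta> i))" if "i \<in> I" for i k
    proof (induction k)
      case 0
      then show ?case using eq_\<beta>[OF that] by simp
    next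
      case (Suc k)
      have "(C ^^ k) (?\<beta> i) \<in> R" using A.C_pow_root \<beta>_root that by blast
      then show ?case using Suc \<Psi>(2) \<Phi>_C by simp
    qed
    have "\<Psi> x = \<Phi> x" if x: "x \<in> R" for x
    proof -
      obtain i n where "i \<in> I" "x = B.\<gamma> i n" using B.gamma_surj[OF x] by blast
      then show ?thesis using eq_orbit by (simp add: B.\<gamma>_def)
    qed
    then show ?thesis using \<Psi>(1) \<Phi>_PiE by (rule PiE_ext[rotated 2])
  qed
  show ?thesis
  proof (rule ex1I[of _ \<Phi>], goal_cases)
    case 1
    have "(\<lambda>i. \<eta> i mod (2 * int h)) \<in> I \<rightarrow> {0..<2 * int h}" using A.h_pos hA by auto
    then have "\<exists>\<eta> \<in> I \<rightarrow> {0..<2 * int h}. \<forall>i\<in>I. \<Phi> (?\<beta> i) = (i, \<eta> i)"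
      by (rule bexI[rotated]) (simp add: \<Phi>_\<beta>)
    then show ?case using \<Phi>_PiE \<Phi>_bij \<Phi>_C \<Phi>_edge \<Phi>_orbit by blast
  next
    case (2 \<Psi>)
    then show ?case by (elim conjE) (rule unique)
  qed
qed

end
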